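(* Let $n$ be an odd integer with $n \ge 27$ and $n \notin \{33,35,37,41,43,47,51\}$. Then there exists an idempotent symmetric latin square $L$ of order $n$ such that for every row index $r$, column index $c$ and symbol $s$, there is a proper latin subsquare of $L$ whose rows include $r$, whose columns include $c$, and whose symbols include $s$.
   Context: A latin square of order $n$ is an $n\times n$ array with entries from $[n]=\{1,\dots,n\}$ in which every row and every column is a permutation of $[n]$; rows and columns are indexed by $[n]$. It is symmetric if $L_{ij} = L_{ji}$ for all $i,j$, and idempotent if $L_{ii} = i$ for all $i$. A latin subsquare is a sub-array determined by a set $R$ of rows and a set $C$ of columns (not necessarily contiguous) which is itself a latin square on some set of $|R| = |C|$ symbols; it is proper if it is not the whole square. *)

theory Defs
  imports Main
begin

text \<open>A latin square of order n: an n x n array with rows and columns indexed by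
  {1..n}, entries from {1..n}, each row and column a permutation of {1..n}.
  Values of L outside {1..n} x {1..n} are irrelevant.\<close>
definition latin_square :: "nat \<Rightarrow> (nat \<Rightarrow> nat \<Rightarrow> nat) \<Rightarrow> bool" where
  "latin_square n L \<longleftrightarrow>
     (\<forall>i\<in>{1..n}. bij_betw (\<lambda>j. L i j) {1..n} {1..n}) \<and>
     (\<forall>j\<in>{1..n}. bij_betw (\<lambda>i. L i j) {1..n} {1..n})"

definition symmetric_ls :: "nat \<Rightarrow> (nat \<Rightarrow> nat \<Rightarrow> nat) \<Rightarrow> bool" where
  "symmetric_ls n L \<longleftrightarrow> (\<forall>i\<in>{1..n}. \<forall>j\<in>{1..n}. L i j = L j i)"

definition idempotent_ls :: "nat \<Rightarrow> (nat \<Rightarrow> nat \<Rightarrow> nat) \<Rightarrow> bool" where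
  "idempotent_ls n L \<longleftrightarrow> (\<forall>i\<in>{1..n}. L i i = i)"

definition latin_subsquare ::
  "nat \<Rightarrow> (nat \<Rightarrow> nat \<Rightarrow> nat) \<Rightarrow> nat set \<Rightarrow> nat set \<Rightarrow> nat set \<Rightarrow> bool" where
  "latin_subsquare n L R C S \<longleftrightarrow>
     R \<subseteq> {1..n} \<and> C \<subseteq> {1..n} \<and> card R = card C \<and> card S = card R \<and>
     (\<forall>r\<in>R. bij_betw (\<lambda>c. L r c) C S) \<and>
     (\<forall>c\<in>C. bij_betw (\<lambda>r. L r c) R S)"

definition proper_latin_subsquare ::
  "nat \<Rightarrow> (nat \<Rightarrow> nat \<Rightarrow> nat) \<Rightarrow> nat set \<Rightarrow> nat set \<Rightarrow> nat set \<Rightarrow> bool" where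
  "proper_latin_subsquare n L R C S \<longleftrightarrow>
     latin_subsquare n L R C S \<and> \<not> (R = {1..n} \<and> C = {1..n})"

end

theory Submission
  imports Defs "HOL-Library.Product_Plus" "HOL-Library.Z2" "HOL-Library.Cardinality"
begin

text \<open>
  An idempotent symmetric latin square is a commutative idempotent quasigroup.  A triple
  \<open>(r, c, s)\<close> is covered either by a proper subquasigroup or by a subsquare \<open>R \<times> C \<rightarrow> S\<close> with \<open>R\<close>
  and \<open>C\<close> disjoint.  In the Fano plane, a triple of noncollinear points \<open>x, y, z\<close> lies in the
  subsquare \<open>{x, y + z} \<times> {y, x + z} \<rightarrow> {z, x + y}\<close>; in the affine plane of order 3 it lies in the
  subsquare of cosets of the subgroup generated by \<open>x + y + z\<close>.

  Both kinds of cover survive when every point is replaced by a group of \<open>m\<close> points (group as in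
  group divisible designs) and the groups, enlarged by a common set \<open>W\<close> of \<open>w\<close>
  points, are filled with quasigroups of order \<open>m + w\<close> that contain \<open>W\<close>:
  disjointness of \<open>R\<close> and \<open>C\<close> means that the filling is never met. Hence order
  \<open>t\<close> yields order \<open>t m + w\<close>. The fillings come from starters in the cyclic group of
  even order \<open>m\<close>. With \<open>t = 7\<close> this covers every odd \<open>n \<ge> 169\<close> and
  most smaller ones. The remaining orders come from \<open>t = 9\<close>, from the 26 nonzero vectors over the
  field with 3 elements, and, for 65, 67 and 69, from doubling the affine space of order 3 and dimension 3 and
  adding points at infinity.
\<close>

section \<open>Commutative idempotent quasigroups\<close>

text \<open>By symmetry the off-diagonal cells holding a given symbol come in pairs, and idempotence
  adds one diagonal cell; so such a quasigroup has odd order. Hence for even \<open>m\<close> no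
  group can be filled alone: it needs a common part \<open>W\<close> of odd size, and
  \<open>W\<close> must be a subquasigroup so that the fillings of different groups agree on it. A
  subquasigroup of order \<open>w\<close> in order \<open>m + w\<close> forces w < m, and the
  general starter reaches only about w \<le> m/2. Writing n = 14 k + w with w < 14 and taking
  \<open>t = 7\<close>, \<open>m = 2 k\<close> therefore fails for some small \<open>k\<close>,
  which is why other \<open>t\<close> are needed. The orders 65, 67, 69 are neither 7 m + w nor 9 m
  + w with \<open>m\<close> even, \<open>w\<close> odd and w < m, nor multiples of 7 or 9. They are
  reached as 3 * 18 + w; but the square of order 3 is not itself covered (its rows, columns and
  symbols 0, 1, 0 lie in no proper subsquare), so there the covers must use structure inside the
  groups, namely the lines of a plane.\<close>

definition ciq :: "'a set \<Rightarrow> ('a \<Rightarrow> 'a \<Rightarrow> 'a) \<Rightarrow> bool" where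
  "ciq X f \<longleftrightarrow> finite X \<and> (\<forall>x\<in>X. f x x = x) \<and> (\<forall>x\<in>X. \<forall>y\<in>X. f x y \<in> X \<and> f x y = f y x) \<and>
     (\<forall>x\<in>X. inj_on (f x) X)"

text \<open>Cancellation makes each row of \<open>R\<close> injective on \<open>C\<close>, so equal
  cardinalities already yield a latin subsquare with symbol set \<open>S\<close>. Disjointness of
  \<open>R\<close> and \<open>C\<close> also makes that subsquare proper.\<close>

definition triple_covered :: "'a set \<Rightarrow> ('a \<Rightarrow> 'a \<Rightarrow> 'a) \<Rightarrow> bool" where
  "triple_covered X f \<longleftrightarrow> (\<forall>r\<in>X. \<forall>c\<in>X. \<forall>s\<in>X.
     (\<exists>B. B \<subset> X \<and> (\<forall>x\<in>B. \<forall>y\<in>B. f x y \<in> B) \<and> r \<in> B \<and> c \<in> B \<and> s \<in> B) \<or>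
     (\<exists>R C S. R \<subseteq> X \<and> C \<subseteq> X \<and> R \<inter> C = {} \<and> card R = card C \<and> card S = card R \<and>
        (\<forall>x\<in>R. \<forall>y\<in>C. f x y \<in> S) \<and> r \<in> R \<and> c \<in> C \<and> s \<in> S))"

definition good :: "nat \<Rightarrow> bool" where
  "good n \<longleftrightarrow> (\<exists>f. ciq {1..n} f \<and> triple_covered {1..n} f)"

lemma ciqI:
  assumes "finite X" "\<And>x. x \<in> X \<Longrightarrow> f x x = x"
    "\<And>x y. \<lbrakk>x \<in> X; y \<in> X\<rbrakk> \<Longrightarrow> f x y \<in> X" "\<And>x y. \<lbrakk>x \<in> X; y \<in> X\<rbrakk> \<Longrightarrow> f x y = f y x"
    "\<And>x y z. \<lbrakk>x \<in> X; y \<in> X; z \<in> X; f x y = f x z\<rbrakk> \<Longrightarrow> y = z"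
  shows "ciq X f"
  using assms unfolding ciq_def inj_on_def by blast

lemma
  assumes "ciq X f"
  shows ciq_finite: "finite X"
    and ciq_idem: "x \<in> X \<Longrightarrow> f x x = x"
    and ciq_closed: "\<lbrakk>x \<in> X; y \<in> X\<rbrakk> \<Longrightarrow> f x y \<in> X"
    and ciq_comm: "\<lbrakk>x \<in> X; y \<in> X\<rbrakk> \<Longrightarrow> f x y = f y x"
    and ciq_cancel: "\<lbrakk>x \<in> X; y \<in> X; z \<in> X; f x y = f x z\<rbrakk> \<Longrightarrow> y = z"
  using assms unfolding ciq_def inj_on_def by blast+

lemma triple_coveredE:
  assumes "triple_covered X f" "r \<in> X" "c \<in> X" "s \<in> X"
  obtains (closed) B where "B \<subset> X" "\<And>x y. \<lbrakk>x \<in> B; y \<in> B\<rbrakk> \<Longrightarrow> f x y \<in> B" "r \<in> B" "c \<in> B" "s \<in> B"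
  | (rect) R C S where "R \<subseteq> X" "C \<subseteq> X" "R \<inter> C = {}" "card R = card C" "card S = card R"
      "\<And>x y. \<lbrakk>x \<in> R; y \<in> C\<rbrakk> \<Longrightarrow> f x y \<in> S" "r \<in> R" "c \<in> C" "s \<in> S"
  using assms unfolding triple_covered_def by (metis (no_types, lifting))

lemma goodI:
  fixes X :: "'a set"
  assumes q: "ciq X f" and cov: "triple_covered X f" and n: "card X = n"
  shows "good n"
proof -
  have "finite X" using q by (rule ciq_finite)
  then obtain h where h: "bij_betw h X {1..n}"
    using n by (metis bij_betw_iff_card card_atLeastAtMost diff_Suc_1 finite_atLeastAtMost)
  define g where "g = the_inv_into X h"
  have g: "bij_betw g {1..n} X" unfolding g_def using h by (rule bij_betw_the_inv_into)
  have gh: "g (h x) = x" if "x \<in> X" for x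
    unfolding g_def using h that by (meson bij_betw_imp_inj_on the_inv_into_f_f)
  have hg: "h (g y) = y" if "y \<in> {1..n}" for y
    unfolding g_def using h that by (meson f_the_inv_into_f_bij_betw)
  have gX: "g y \<in> X" if "y \<in> {1..n}" for y using g that by (rule bij_betw_apply)
  have hX: "h x \<in> {1..n}" if "x \<in> X" for x using h that by (rule bij_betw_apply)
  define f' where "f' x y = h (f (g x) (g y))" for x y
  have "ciq {1..n} f'"
  proof (rule ciqI)
    show "f' x x = x" if "x \<in> {1..n}" for x
      unfolding f'_def using that by (simp add: ciq_idem[OF q] gX hg)
    show "f' x y \<in> {1..n}" if "x \<in> {1..n}" "y \<in> {1..n}" for x y
      unfolding f'_def using that by (intro hX ciq_closed[OF q] gX)
    show "f' x y = f' y x" if "x \<in> {1..n}" "y \<in> {1..n}" for x y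
      unfolding f'_def using that by (simp only: ciq_comm[OF q gX gX])
    show "y = z" if "x \<in> {1..n}" "y \<in> {1..n}" "z \<in> {1..n}" "f' x y = f' x z" for x y z
    proof -
      have "f (g x) (g y) = f (g x) (g z)"
        using that gh[OF ciq_closed[OF q gX gX]] unfolding f'_def by metis
      then have "g y = g z" using ciq_cancel[OF q] that gX by blast
      then show "y = z" using that hg by metis
    qed
  qed simp
  moreover have "triple_covered {1..n} f'"
    unfolding triple_covered_def
  proof (intro ballI)
    fix r c s assume rcs: "r \<in> {1..n}" "c \<in> {1..n}" "s \<in> {1..n}"
    have inj: "inj_on h X" using h by (rule bij_betw_imp_inj_on)
    have img: "h ` X = {1..n}" using h by (rule bij_betw_imp_surj_on)
    show "(\<exists>B. B \<subset> {1..n} \<and> (\<forall>x\<in>B. \<forall>y\<in>B. f' x y \<in> B) \<and> r \<in> B \<and> c \<in> B \<and> s \<in> B) \<or>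
     (\<exists>R C S. R \<subseteq> {1..n} \<and> C \<subseteq> {1..n} \<and> R \<inter> C = {} \<and> card R = card C \<and> card S = card R \<and>
        (\<forall>x\<in>R. \<forall>y\<in>C. f' x y \<in> S) \<and> r \<in> R \<and> c \<in> C \<and> s \<in> S)"
      using cov gX[OF rcs(1)] gX[OF rcs(2)] gX[OF rcs(3)]
    proof (cases rule: triple_coveredE)
      case (closed B)
      have "h ` B \<subset> {1..n}"
        using closed(1) inj img by (metis image_mono inj_on_image_eq_iff psubset_eq subset_refl)
      moreover have "\<forall>x\<in>h ` B. \<forall>y\<in>h ` B. f' x y \<in> h ` B"
        unfolding f'_def using closed(1,2) gh by (auto simp: subset_iff psubset_eq)
      moreover have "r \<in> h ` B" "c \<in> h ` B" "s \<in> h ` B"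
        using closed(3-5) rcs hg by (metis imageI)+
      ultimately show ?thesis by blast
    next
      case (rect R C S)
      \<comment> \<open>Row \<open>g r\<close> maps \<open>C\<close> injectively into
        \<open>S\<close>, a finite set of the same size; so \<open>S\<close> is the image and
        consists of products.\<close>
      have S: "S \<subseteq> X"
      proof -
        have "inj_on (f (g r)) C"
          using rect(1,2,7) ciq_cancel[OF q] unfolding inj_on_def by blast
        then have "card (f (g r) ` C) = card S" using rect(4,5) by (simp add: card_image)
        moreover have "f (g r) ` C \<subseteq> S" using rect(6,7) by blast
        moreover have "finite S"
          using rect(1,5,7) \<open>finite X\<close> by (metis card_gt_0_iff empty_iff finite_subset)
        ultimately have "f (g r) ` C = S" by (simp add: card_subset_eq)
        then show ?thesis using rect(1,2,7) ciq_closed[OF q] by blast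
      qed
      have "h ` R \<subseteq> {1..n}" "h ` C \<subseteq> {1..n}" using rect(1,2) img by auto
      moreover have "h ` R \<inter> h ` C = {}"
        using rect(1-3) inj by (metis image_empty inj_on_image_Int)
      moreover have "card (h ` R) = card (h ` C)" "card (h ` S) = card (h ` R)"
        using rect(1,2,4,5) S inj by (metis card_image inj_on_subset)+
      moreover have "\<forall>x\<in>h ` R. \<forall>y\<in>h ` C. f' x y \<in> h ` S"
        unfolding f'_def using rect(1,2,6) gh by (auto simp: subset_iff)
      moreover have "r \<in> h ` R" "c \<in> h ` C" "s \<in> h ` S"
        using rect(7-9) rcs hg by (metis imageI)+
      ultimately show ?thesis
        by (intro disjI2 exI[of _ "h ` R"] exI[of _ "h ` C"] exI[of _ "h ` S"]) simp
    qed
  qed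
  ultimately show ?thesis unfolding good_def by blast
qed

lemma good_imp_latin_square:
  assumes "good n"
  shows "\<exists>L. latin_square n L \<and> symmetric_ls n L \<and> idempotent_ls n L \<and>
           (\<forall>r\<in>{1..n}. \<forall>c\<in>{1..n}. \<forall>s\<in>{1..n}.
              \<exists>R C S. proper_latin_subsquare n L R C S \<and> r \<in> R \<and> c \<in> C \<and> s \<in> S)"
proof -
  obtain f where q: "ciq {1..n} f" and cov: "triple_covered {1..n} f"
    using assms unfolding good_def by blast
  have row: "bij_betw (\<lambda>y. f x y) C S"
    if "x \<in> {1..n}" "C \<subseteq> {1..n}" "\<And>y. y \<in> C \<Longrightarrow> f x y \<in> S" "card S = card C" "finite S" for x C S
  proof -
    have "inj_on (f x) C" using that(1,2) ciq_cancel[OF q] unfolding inj_on_def by blast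
    moreover from this have "f x ` C = S"
      using that by (intro card_subset_eq) (auto simp: card_image)
    ultimately show ?thesis by (auto simp: bij_betw_def)
  qed
  have col: "bij_betw (\<lambda>x. f x y) R S"
    if "y \<in> {1..n}" "R \<subseteq> {1..n}" "\<And>x. x \<in> R \<Longrightarrow> f x y \<in> S" "card S = card R" "finite S" for y R S
  proof -
    have eq: "f x y = f y x" if "x \<in> R" for x
      using that \<open>y \<in> {1..n}\<close> \<open>R \<subseteq> {1..n}\<close> ciq_comm[OF q] by blast
    show ?thesis using row[of y R S] that eq by (simp cong: bij_betw_cong)
  qed
  have sub: "latin_subsquare n f R C S"
    if "R \<subseteq> {1..n}" "C \<subseteq> {1..n}" "card R = card C" "card S = card R" "finite S"
      "\<And>x y. \<lbrakk>x \<in> R; y \<in> C\<rbrakk> \<Longrightarrow> f x y \<in> S" for R C S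
    unfolding latin_subsquare_def using that by (auto intro!: row col)
  have "latin_square n f"
    using sub[of "{1..n}" "{1..n}" "{1..n}"] ciq_closed[OF q]
    by (auto simp: latin_square_def latin_subsquare_def)
  moreover have "symmetric_ls n f" using ciq_comm[OF q] by (auto simp: symmetric_ls_def)
  moreover have "idempotent_ls n f" using ciq_idem[OF q] by (auto simp: idempotent_ls_def)
  moreover have "\<exists>R C S. proper_latin_subsquare n f R C S \<and> r \<in> R \<and> c \<in> C \<and> s \<in> S"
    if rcs: "r \<in> {1..n}" "c \<in> {1..n}" "s \<in> {1..n}" for r c s
    using cov rcs
  proof (cases rule: triple_coveredE)
    case (closed B)
    then have "finite B" by (meson finite_atLeastAtMost finite_subset psubset_imp_subset)
    then have "latin_subsquare n f B B B" using closed by (intro sub) auto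
    then show ?thesis using closed unfolding proper_latin_subsquare_def by blast
  next
    case (rect R C S)
    have "finite S"
      using rect(1,5,7) by (metis card_gt_0_iff empty_iff finite_atLeastAtMost finite_subset)
    then have "latin_subsquare n f R C S" using rect by (intro sub) auto
    moreover have "\<not> (R = {1..n} \<and> C = {1..n})" using rect by blast
    ultimately show ?thesis using rect unfolding proper_latin_subsquare_def by blast
  qed
  ultimately show ?thesis by blast
qed

section \<open>Filling groups\<close>

text \<open>Groups \<open>{g} \<times> D\<close>; products across groups come from \<open>h\<close>, and each group together with the
  common part \<open>W\<close> carries a copy of the quasigroup \<open>q\<close>.  As \<open>W\<close> is closed under \<open>q\<close>, the
  \<open>undefined\<close> group never shows up.\<close>
definition fill :: "('g \<times> 'd \<Rightarrow> 'g \<times> 'd \<Rightarrow> 'g \<times> 'd) \<Rightarrow> ('d + 'w \<Rightarrow> 'd + 'w \<Rightarrow> 'd + 'w) \<Rightarrow>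
    ('g \<times> 'd) + 'w \<Rightarrow> ('g \<times> 'd) + 'w \<Rightarrow> ('g \<times> 'd) + 'w" where
  "fill h q u v = (case u of
      Inl x \<Rightarrow> (case v of
          Inl y \<Rightarrow> if fst x = fst y then map_sum (Pair (fst x)) id (q (Inl (snd x)) (Inl (snd y)))
                   else Inl (h x y)
        | Inr j \<Rightarrow> map_sum (Pair (fst x)) id (q (Inl (snd x)) (Inr j)))
    | Inr i \<Rightarrow> (case v of
          Inl y \<Rightarrow> map_sum (Pair (fst y)) id (q (Inr i) (Inl (snd y)))
        | Inr j \<Rightarrow> map_sum (Pair undefined) id (q (Inr i) (Inr j))))"

text \<open>Row \<open>x\<close> of \<open>h\<close> permutes the points outside the group of
  \<open>x\<close>, and a product never falls into the group of either factor. Nothing is asked of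
  \<open>h\<close> inside a group, in particular no idempotence, so \<open>D\<close> may have even
  size; \<open>q\<close> supplies the missing products.\<close>

locale frame =
  fixes \<Gamma> :: "'g set" and D :: "'d set" and W :: "'w set"
    and h :: "'g \<times> 'd \<Rightarrow> 'g \<times> 'd \<Rightarrow> 'g \<times> 'd"
    and q :: "'d + 'w \<Rightarrow> 'd + 'w \<Rightarrow> 'd + 'w"
  assumes finite_groups: "finite \<Gamma>"
    and h_closed: "\<And>x y. \<lbrakk>x \<in> \<Gamma> \<times> D; y \<in> \<Gamma> \<times> D; fst x \<noteq> fst y\<rbrakk> \<Longrightarrow> h x y \<in> \<Gamma> \<times> D"
    and h_group: "\<And>x y. \<lbrakk>x \<in> \<Gamma> \<times> D; y \<in> \<Gamma> \<times> D; fst x \<noteq> fst y\<rbrakk> \<Longrightarrow> fst (h x y) \<noteq> fst x"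
    and h_comm: "\<And>x y. \<lbrakk>x \<in> \<Gamma> \<times> D; y \<in> \<Gamma> \<times> D; fst x \<noteq> fst y\<rbrakk> \<Longrightarrow> h x y = h y x"
    and h_cancel: "\<And>x y z. \<lbrakk>x \<in> \<Gamma> \<times> D; y \<in> \<Gamma> \<times> D; z \<in> \<Gamma> \<times> D; fst x \<noteq> fst y; fst x \<noteq> fst z;
        h x y = h x z\<rbrakk> \<Longrightarrow> y = z"
    and q: "ciq (D <+> W) q"
    and W_closed: "\<And>i j. \<lbrakk>i \<in> W; j \<in> W\<rbrakk> \<Longrightarrow> q (Inr i) (Inr j) \<in> Inr ` W"
begin

abbreviation X :: "(('g \<times> 'd) + 'w) set" where "X \<equiv> (\<Gamma> \<times> D) <+> W"

lemma finite_D: "finite D" and finite_W: "finite W"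
  using ciq_finite[OF q] by (simp_all add: finite_Plus_iff)

text \<open>Row \<open>i\<close> of \<open>q\<close> permutes the finite set \<open>W\<close>, hence also its complement \<open>D\<close>.\<close>
lemma q_Inr_Inl:
  assumes "i \<in> W" "a \<in> D"
  shows "q (Inr i) (Inl a) \<in> Inl ` D"
proof -
  have inj: "inj_on (q (Inr i)) (D <+> W)" using q assms unfolding ciq_def by blast
  have "q (Inr i) ` Inr ` W \<subseteq> Inr ` W" using W_closed assms by blast
  moreover have "inj_on (q (Inr i)) (Inr ` W)" using inj by (rule inj_on_subset) auto
  ultimately have surj: "q (Inr i) ` Inr ` W = Inr ` W"
    using finite_W by (simp add: endo_inj_surj)
  have "q (Inr i) (Inl a) \<notin> Inr ` W"
  proof
    assume "q (Inr i) (Inl a) \<in> Inr ` W"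
    then obtain j where "j \<in> W" "q (Inr i) (Inl a) = q (Inr i) (Inr j)" using surj by (metis imageE)
    then show False using inj assms by (auto dest!: inj_onD)
  qed
  moreover have "q (Inr i) (Inl a) \<in> D <+> W" using assms by (intro ciq_closed[OF q]) auto
  ultimately show ?thesis by auto
qed

text \<open>On an enlarged group \<open>fill\<close> is \<open>q\<close> transported along
  \<open>map_sum (Pair g) id\<close>. For two elements of \<open>W\<close> this is true for every
  \<open>g\<close> at once, because by \<open>W_closed\<close> their product carries no group
  tag.\<close>

lemma fill_same_group:
  assumes "u \<in> map_sum (Pair g) id ` (D <+> W)" "v \<in> map_sum (Pair g) id ` (D <+> W)"
  obtains u' v' where "u' \<in> D <+> W" "v' \<in> D <+> W" "u = map_sum (Pair g) id u'"
    "v = map_sum (Pair g) id v'" "fill h q u v = map_sum (Pair g) id (q u' v')"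
proof -
  obtain u' v' where uv: "u' \<in> D <+> W" "v' \<in> D <+> W" "u = map_sum (Pair g) id u'"
    "v = map_sum (Pair g) id v'" using assms by blast
  have "fill h q u v = map_sum (Pair g) id (q u' v')"
    using uv W_closed by (cases u'; cases v') (force simp: fill_def)+
  then show ?thesis using that uv by blast
qed

lemma fill_cross: "fst x \<noteq> fst y \<Longrightarrow> fill h q (Inl x) (Inl y) = Inl (h x y)"
  by (simp add: fill_def)

lemma same_group_or_cross:
  assumes "u \<in> X" "v \<in> X" "\<Gamma> \<noteq> {}"
  obtains g where "g \<in> \<Gamma>" "u \<in> map_sum (Pair g) id ` (D <+> W)" "v \<in> map_sum (Pair g) id ` (D <+> W)"
  | x y where "x \<in> \<Gamma> \<times> D" "y \<in> \<Gamma> \<times> D" "u = Inl x" "v = Inl y" "fst x \<noteq> fst y"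
proof -
  \<comment> \<open>Two elements of \<open>W\<close> belong to every enlarged group, so any group
    serves for them.\<close>
  obtain g0 where "g0 \<in> \<Gamma>" using assms(3) by blast
  have L: "Inl (g, a) \<in> map_sum (Pair g) id ` (D <+> W)" if "a \<in> D" for g :: 'g and a
    using that by (intro image_eqI[of _ _ "Inl a"]) auto
  have R: "Inr i \<in> map_sum (Pair g) id ` (D <+> W)" if "i \<in> W" for g :: 'g and i
    using that by (intro image_eqI[of _ _ "Inr i"]) auto
  show ?thesis
    using assms(1,2) that L R \<open>g0 \<in> \<Gamma>\<close> by (auto elim!: PlusE) (metis fst_conv mem_Sigma_iff)+
qed

lemma ciq_fill:
  assumes "\<Gamma> \<noteq> {}"
  shows "ciq X (fill h q)"
proof (rule ciqI)
  show "finite X" using finite_groups finite_D finite_W by simp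
  have grp: "map_sum (Pair g) id ` (D <+> W) \<subseteq> X" if "g \<in> \<Gamma>" for g
    using that by auto
  have inj: "inj (map_sum (Pair g) id :: 'd + 'w \<Rightarrow> _)" for g :: 'g
    by (rule sum.inj_map) (auto simp: inj_def)
  show "fill h q u u = u" if "u \<in> X" for u
    using same_group_or_cross[OF that that assms]
  proof cases
    case (1 g)
    obtain u' v' where uv: "u' \<in> D <+> W" "v' \<in> D <+> W" "u = map_sum (Pair g) id u'"
        "u = map_sum (Pair g) id v'" "fill h q u u = map_sum (Pair g) id (q u' v')"
      by (rule fill_same_group[OF 1(2,3)])
    then have "u' = v'" using inj by (metis injD)
    then show ?thesis using uv by (simp add: ciq_idem[OF q])
  qed simp
  show "fill h q u v \<in> X" if "u \<in> X" "v \<in> X" for u v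
    using same_group_or_cross[OF that assms]
  proof cases
    case (1 g)
    obtain u' v' where uv: "u' \<in> D <+> W" "v' \<in> D <+> W" "u = map_sum (Pair g) id u'"
        "v = map_sum (Pair g) id v'" "fill h q u v = map_sum (Pair g) id (q u' v')"
      by (rule fill_same_group[OF 1(2,3)])
    have "q u' v' \<in> D <+> W" using uv by (intro ciq_closed[OF q])
    then show ?thesis using uv(5) 1(1) by auto
  next
    case (2 x y)
    then show ?thesis using h_closed by (simp add: fill_cross InlI)
  qed
  show "fill h q u v = fill h q v u" if "u \<in> X" "v \<in> X" for u v
    using same_group_or_cross[OF that assms]
  proof cases
    case (1 g)
    obtain u' v' where uv: "u' \<in> D <+> W" "v' \<in> D <+> W" "u = map_sum (Pair g) id u'"
        "v = map_sum (Pair g) id v'" "fill h q u v = map_sum (Pair g) id (q u' v')"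
      by (rule fill_same_group[OF 1(2,3)])
    obtain v'' u'' where uv': "v'' \<in> D <+> W" "u'' \<in> D <+> W" "v = map_sum (Pair g) id v''"
        "u = map_sum (Pair g) id u''" "fill h q v u = map_sum (Pair g) id (q v'' u'')"
      by (rule fill_same_group[OF 1(3,2)])
    have "u'' = u'" "v'' = v'" using uv uv' inj by (metis injD)+
    then show ?thesis using uv uv' ciq_comm[OF q uv(1,2)] by simp
  next
    case (2 x y)
    then show ?thesis using h_comm by (simp add: fill_cross)
  qed
  show "v = v'" if "u \<in> X" "v \<in> X" "v' \<in> X" and eq: "fill h q u v = fill h q u v'" for u v v'
  proof -
    \<comment> \<open>A product inside the enlarged group of \<open>u\<close> has tag
      \<open>g\<close> or lies in \<open>W\<close>; a product across groups is a point outside that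
      group by \<open>h_group\<close>. The two never agree.\<close>
    have mixed: False
      if 1: "g \<in> \<Gamma>" "u \<in> map_sum (Pair g) id ` (D <+> W)" "v \<in> map_sum (Pair g) id ` (D <+> W)"
        and 2: "x \<in> \<Gamma> \<times> D" "y \<in> \<Gamma> \<times> D" "u = Inl x" "v' = Inl y" "fst x \<noteq> fst y"
        and eq: "fill h q u v = fill h q u v'" for g x y v v'
    proof -
      obtain u1 v1 where uv: "fill h q u v = map_sum (Pair g) id (q u1 v1)"
        by (rule fill_same_group[OF 1(2,3)]) blast
      moreover have "fill h q u v' = Inl (h x y)" using 2 by (simp add: fill_cross)
      ultimately have "fst (h x y) = g" using eq by (cases "q u1 v1") auto
      moreover have "fst x = g" using 1(2) 2(3) by auto
      ultimately show False using h_group[OF 2(1,2,5)] by simp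
    qed
    show ?thesis
      using same_group_or_cross[OF that(1,2) assms]
    proof cases
      case v: (1 g)
      show ?thesis
        using same_group_or_cross[OF that(1,3) assms]
      proof cases
        case v': (1 g')
        show ?thesis
        proof (cases "g = g'")
          case True
          obtain u1 v1 where 1: "u1 \<in> D <+> W" "v1 \<in> D <+> W" "u = map_sum (Pair g) id u1"
            "v = map_sum (Pair g) id v1" "fill h q u v = map_sum (Pair g) id (q u1 v1)"
            by (rule fill_same_group[OF v(2,3)])
          obtain u2 v2 where 2: "u2 \<in> D <+> W" "v2 \<in> D <+> W" "u = map_sum (Pair g) id u2"
            "v' = map_sum (Pair g) id v2" "fill h q u v' = map_sum (Pair g) id (q u2 v2)"
            by (rule fill_same_group[OF v'(2,3)[folded True]])
          have "u1 = u2" using 1 2 inj by (metis injD)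
          moreover have "q u1 v1 = q u2 v2" using 1 2 eq inj by (metis injD)
          ultimately have "v1 = v2" using ciq_cancel[OF q] 1 2 by blast
          then show ?thesis using 1 2 by simp
        next
          case False
          \<comment> \<open>Lying in two different enlarged groups, \<open>u\<close> is in
            \<open>W\<close>. Its row maps \<open>D\<close> to \<open>D\<close>, \<open>W\<close> to
            \<open>W\<close> and keeps the group tag, so \<open>v\<close> has to be in
            \<open>W\<close>; then \<open>v\<close> also belongs to the enlarged group
            \<open>g'\<close>, and cancellation in \<open>q\<close> applies.\<close>
          then obtain i where u: "u = Inr i" "i \<in> W" using v(2) v'(2) by auto
          show ?thesis
          proof (cases v)
            case (Inl a)
            then obtain a' where a: "a = (g, a')" "a' \<in> D" using v(3) by auto
            obtain b where b: "q (Inr i) (Inl a') = Inl b" using q_Inr_Inl u a by blast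
            have fv: "fill h q u v = Inl (g, b)" using u Inl a b by (simp add: fill_def)
            show ?thesis
            proof (cases v')
              case (Inl c)
              then obtain c' where c: "c = (g', c')" "c' \<in> D" using v'(3) by auto
              then show ?thesis using False eq fv u Inl q_Inr_Inl[OF u(2) c(2)] by (auto simp: fill_def)
            next
              case (Inr j)
              then have "j \<in> W" using v'(3) by auto
              then show ?thesis using eq fv u Inr W_closed[OF u(2)] by (force simp: fill_def)
            qed
          next
            case (Inr j)
            then have j: "j \<in> W" using v(3) by auto
            then have v2: "v \<in> map_sum (Pair g') id ` (D <+> W)"
              using Inr by (intro image_eqI[of _ _ "Inr j"]) auto
            obtain u1 v1 where 1: "u1 \<in> D <+> W" "v1 \<in> D <+> W" "u = map_sum (Pair g') id u1"
              "v = map_sum (Pair g') id v1" "fill h q u v = map_sum (Pair g') id (q u1 v1)"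
              by (rule fill_same_group[OF v'(2) v2])
            obtain u2 v2 where 2: "u2 \<in> D <+> W" "v2 \<in> D <+> W" "u = map_sum (Pair g') id u2"
              "v' = map_sum (Pair g') id v2" "fill h q u v' = map_sum (Pair g') id (q u2 v2)"
              by (rule fill_same_group[OF v'(2,3)])
            have "u1 = u2" using 1 2 inj by (metis injD)
            moreover have "q u1 v1 = q u2 v2" using 1 2 eq inj by (metis injD)
            ultimately have "v1 = v2" using ciq_cancel[OF q] 1 2 by blast
            then show ?thesis using 1 2 by simp
          qed
        qed
      next
        case v': (2 x y)
        show ?thesis using mixed[OF v v' eq] by simp
      qed
    next
      case v: (2 x y)
      show ?thesis
        using same_group_or_cross[OF that(1,3) assms]
      proof cases
        case v': (1 g')
        show ?thesis using mixed[OF v' v eq[symmetric]] by simp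
      next
        case v': (2 x' y')
        have "x' = x" "h x y = h x y'" using v v' eq by (auto simp: fill_cross)
        then have "y = y'" using v v' by (intro h_cancel[of x y y']) auto
        then show ?thesis using v v' by simp
      qed
    qed
  qed
qed

text \<open>The groups in \<open>B\<close> form a frame of their own with the same \<open>h\<close>
  and \<open>q\<close>, so closure is read off from \<open>ciq_fill\<close> for that smaller
  frame.\<close>

lemma fill_closed_groups:
  assumes "B \<subseteq> \<Gamma>" "B \<noteq> {}"
    and "\<And>x y. \<lbrakk>x \<in> B \<times> D; y \<in> B \<times> D; fst x \<noteq> fst y\<rbrakk> \<Longrightarrow> fst (h x y) \<in> B"
    and "u \<in> (B \<times> D) <+> W" "v \<in> (B \<times> D) <+> W"
  shows "fill h q u v \<in> (B \<times> D) <+> W"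
proof -
  interpret sub: frame B D W h q
  proof
    show "finite B" using assms(1) finite_groups by (rule finite_subset)
    show "h x y \<in> B \<times> D" if "x \<in> B \<times> D" "y \<in> B \<times> D" "fst x \<noteq> fst y" for x y
      using assms(3)[OF that] h_closed[of x y] that assms(1) by (auto simp: mem_Times_iff)
    fix x y z assume "x \<in> B \<times> D" "y \<in> B \<times> D" "z \<in> B \<times> D"
    then have xyz: "x \<in> \<Gamma> \<times> D" "y \<in> \<Gamma> \<times> D" "z \<in> \<Gamma> \<times> D" using assms(1) by auto
    show "y = z" if "fst x \<noteq> fst y" "fst x \<noteq> fst z" "h x y = h x z"
      using xyz that by (rule h_cancel)
  next
    fix x y assume "x \<in> B \<times> D" "y \<in> B \<times> D" and ne: "fst x \<noteq> fst y"
    then have xy: "x \<in> \<Gamma> \<times> D" "y \<in> \<Gamma> \<times> D" using assms(1) by auto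
    show "fst (h x y) \<noteq> fst x" using xy ne by (rule h_group)
    show "h x y = h y x" using xy ne by (rule h_comm)
  qed (fact q, fact W_closed)
  show ?thesis using ciq_closed[OF sub.ciq_fill[OF assms(2)]] assms(4,5) by blast
qed

text \<open>In the disjoint alternative no product inside a group occurs, so \<open>q\<close> and \<open>W\<close> play no role there.\<close>
lemma triple_covered_fill:
  assumes ne: "\<Gamma> \<noteq> {}" "D \<noteq> {}"
    and cov: "\<And>x y z. \<lbrakk>x \<in> \<Gamma> \<times> D; y \<in> \<Gamma> \<times> D; z \<in> \<Gamma> \<times> D\<rbrakk> \<Longrightarrow>
      (\<exists>B. B \<subset> \<Gamma> \<and> fst x \<in> B \<and> fst y \<in> B \<and> fst z \<in> B \<and>
         (\<forall>u \<in> B \<times> D. \<forall>v \<in> B \<times> D. fst u \<noteq> fst v \<longrightarrow> fst (h u v) \<in> B)) \<or>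
      (\<exists>R C S. R \<subseteq> \<Gamma> \<times> D \<and> C \<subseteq> \<Gamma> \<times> D \<and> fst ` R \<inter> fst ` C = {} \<and> card R = card C \<and>
         card S = card R \<and> (\<forall>u\<in>R. \<forall>v\<in>C. h u v \<in> S) \<and> x \<in> R \<and> y \<in> C \<and> z \<in> S)"
  shows "triple_covered X (fill h q)"
proof -
  obtain d0 where d0: "d0 \<in> \<Gamma> \<times> D" using ne by blast
  \<comment> \<open>Elements of \<open>W\<close> lie in every closed set
    \<open>B \<times> D <+> W\<close>, so an arbitrary point \<open>d0\<close> may stand for
    them.\<close>
  define pt :: "('g \<times> 'd) + 'w \<Rightarrow> 'g \<times> 'd" where "pt u = (case u of Inl x \<Rightarrow> x | Inr _ \<Rightarrow> d0)" for u
  have pt: "pt u \<in> \<Gamma> \<times> D" if "u \<in> X" for u using that d0 by (auto simp: pt_def)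
  have mem: "u \<in> (B \<times> D) <+> W" if "u \<in> X" "isl u \<Longrightarrow> fst (pt u) \<in> B" for u B
    using that by (auto simp: pt_def)
  have flat: "B \<times> D <+> W \<subset> X \<and> (\<forall>u\<in>B \<times> D <+> W. \<forall>v\<in>B \<times> D <+> W. fill h q u v \<in> B \<times> D <+> W)"
    if B: "B \<subset> \<Gamma>" "B \<noteq> {}"
      "\<forall>u \<in> B \<times> D. \<forall>v \<in> B \<times> D. fst u \<noteq> fst v \<longrightarrow> fst (h u v) \<in> B" for B
  proof
    obtain g a where "g \<in> \<Gamma>" "g \<notin> B" "a \<in> D" using B(1) ne(2) by blast
    then have "Inl (g, a) \<in> X" "Inl (g, a) \<notin> B \<times> D <+> W" by auto
    moreover have "B \<times> D <+> W \<subseteq> X" using B(1) by auto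
    ultimately show "B \<times> D <+> W \<subset> X" by blast
    show "\<forall>u\<in>B \<times> D <+> W. \<forall>v\<in>B \<times> D <+> W. fill h q u v \<in> B \<times> D <+> W"
    proof (intro ballI)
      fix u v assume uv: "u \<in> B \<times> D <+> W" "v \<in> B \<times> D <+> W"
      show "fill h q u v \<in> B \<times> D <+> W"
        by (rule fill_closed_groups[OF psubset_imp_subset[OF B(1)] B(2) _ uv]) (use B(3) in blast)
    qed
  qed
  \<comment> \<open>With the same point as row and as column the rectangle alternative is
    impossible, since the groups of \<open>R\<close> and \<open>C\<close> are disjoint. So any two
    points share a closed set, which is all that a triple meeting \<open>W\<close> requires.\<close>
  have pair: "\<exists>B. B \<subset> \<Gamma> \<and> fst x \<in> B \<and> fst y \<in> B \<and>
         (\<forall>u \<in> B \<times> D. \<forall>v \<in> B \<times> D. fst u \<noteq> fst v \<longrightarrow> fst (h u v) \<in> B)"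
    if "x \<in> \<Gamma> \<times> D" "y \<in> \<Gamma> \<times> D" for x y
    using cov[OF that(1,1,2)] by blast
  show ?thesis
    unfolding triple_covered_def
  proof (intro ballI)
    fix r c s assume rcs: "r \<in> X" "c \<in> X" "s \<in> X"
    have by_flat: "\<exists>B. B \<subset> X \<and> (\<forall>x\<in>B. \<forall>y\<in>B. fill h q x y \<in> B) \<and> r \<in> B \<and> c \<in> B \<and> s \<in> B"
      if "B \<subset> \<Gamma>" "B \<noteq> {}"
        "\<forall>u \<in> B \<times> D. \<forall>v \<in> B \<times> D. fst u \<noteq> fst v \<longrightarrow> fst (h u v) \<in> B"
        "isl r \<Longrightarrow> fst (pt r) \<in> B" "isl c \<Longrightarrow> fst (pt c) \<in> B" "isl s \<Longrightarrow> fst (pt s) \<in> B" for B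
      using flat[OF that(1-3)] mem[OF rcs(1) that(4)] mem[OF rcs(2) that(5)] mem[OF rcs(3) that(6)]
      by (intro exI[of _ "B \<times> D <+> W"]) simp
    consider "\<not> isl r" | "\<not> isl c" | "\<not> isl s" | "isl r" "isl c" "isl s" by blast
    then show "(\<exists>B. B \<subset> X \<and> (\<forall>x\<in>B. \<forall>y\<in>B. fill h q x y \<in> B) \<and> r \<in> B \<and> c \<in> B \<and> s \<in> B) \<or>
       (\<exists>R C S. R \<subseteq> X \<and> C \<subseteq> X \<and> R \<inter> C = {} \<and> card R = card C \<and> card S = card R \<and>
          (\<forall>x\<in>R. \<forall>y\<in>C. fill h q x y \<in> S) \<and> r \<in> R \<and> c \<in> C \<and> s \<in> S)"
    proof cases
      case 1
      obtain B where "B \<subset> \<Gamma>" "fst (pt c) \<in> B" "fst (pt s) \<in> B"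
         "\<forall>u \<in> B \<times> D. \<forall>v \<in> B \<times> D. fst u \<noteq> fst v \<longrightarrow> fst (h u v) \<in> B"
        using pair[OF pt[OF rcs(2)] pt[OF rcs(3)]] by blast
      with 1 show ?thesis by (intro disjI1 by_flat[of B]) auto
    next
      case 2
      obtain B where "B \<subset> \<Gamma>" "fst (pt r) \<in> B" "fst (pt s) \<in> B"
         "\<forall>u \<in> B \<times> D. \<forall>v \<in> B \<times> D. fst u \<noteq> fst v \<longrightarrow> fst (h u v) \<in> B"
        using pair[OF pt[OF rcs(1)] pt[OF rcs(3)]] by blast
      with 2 show ?thesis by (intro disjI1 by_flat[of B]) auto
    next
      case 3
      obtain B where "B \<subset> \<Gamma>" "fst (pt r) \<in> B" "fst (pt c) \<in> B"
         "\<forall>u \<in> B \<times> D. \<forall>v \<in> B \<times> D. fst u \<noteq> fst v \<longrightarrow> fst (h u v) \<in> B"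
        using pair[OF pt[OF rcs(1)] pt[OF rcs(2)]] by blast
      with 3 show ?thesis by (intro disjI1 by_flat[of B]) auto
    next
      case 4
      then obtain x y z where xyz: "r = Inl x" "c = Inl y" "s = Inl z"
        by (auto simp: isl_def)
      then have "x \<in> \<Gamma> \<times> D" "y \<in> \<Gamma> \<times> D" "z \<in> \<Gamma> \<times> D" using rcs by auto
      from cov[OF this] show ?thesis
      proof (elim disjE exE conjE)
        fix B assume "B \<subset> \<Gamma>" "fst x \<in> B" "fst y \<in> B" "fst z \<in> B"
          "\<forall>u \<in> B \<times> D. \<forall>v \<in> B \<times> D. fst u \<noteq> fst v \<longrightarrow> fst (h u v) \<in> B"
        then show ?thesis using xyz by (intro disjI1 by_flat[of B]) (auto simp: pt_def)
      next
        fix R C S assume *: "R \<subseteq> \<Gamma> \<times> D" "C \<subseteq> \<Gamma> \<times> D" "fst ` R \<inter> fst ` C = {}" "card R = card C"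
         "card S = card R" "\<forall>u\<in>R. \<forall>v\<in>C. h u v \<in> S" "x \<in> R" "y \<in> C" "z \<in> S"
        have "\<forall>u\<in>Inl ` R. \<forall>v\<in>Inl ` C. fill h q u v \<in> Inl ` S"
        proof (intro ballI)
          fix u v :: "('g \<times> 'd) + 'w" assume "u \<in> Inl ` R" "v \<in> Inl ` C"
          then obtain u' v' where uv: "u = Inl u'" "v = Inl v'" "u' \<in> R" "v' \<in> C" by blast
          then have "fst u' \<noteq> fst v'" using *(3) by blast
          then show "fill h q u v \<in> Inl ` S" using uv *(6) by (simp add: fill_cross)
        qed
        moreover have "Inl ` R \<subseteq> X" "Inl ` C \<subseteq> X" "Inl ` R \<inter> Inl ` C = {}"
          using *(1-3) by auto
        moreover have "card (Inl ` R) = card (Inl ` C)" "card (Inl ` S) = card (Inl ` R)"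
          using *(4,5) by (simp_all add: card_image)
        moreover have "r \<in> Inl ` R" "c \<in> Inl ` C" "s \<in> Inl ` S" using * xyz by auto
        ultimately show ?thesis by (intro disjI2 exI[of _ "Inl ` R"] exI[of _ "Inl ` C"] exI[of _ "Inl ` S"]) simp
      qed
    qed
  qed
qed

lemma card_X: "card X = card \<Gamma> * card D + card W"
  using finite_groups finite_D finite_W by (simp add: card_Plus card_cartesian_product)

end

text \<open>An idempotent commutative quasigroup of order \<open>m + w\<close> with a subquasigroup
  of order \<open>w\<close>. The other points are residues modulo \<open>m\<close> because the
  starters work in the cyclic group.\<close>

definition extends :: "nat \<Rightarrow> nat \<Rightarrow> bool" where
  "extends m w \<longleftrightarrow> (\<exists>q. ciq ({0..<int m} <+> {..<w}) q \<and>
     (\<forall>i<w. \<forall>j<w. q (Inr i) (Inr j) \<in> Inr ` {..<w}))"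

lemma add_mod_cancel:
  fixes m :: int
  assumes "a \<in> {0..<m}" "b \<in> {0..<m}" "(c + a) mod m = (c + b) mod m"
  shows "a = b"
proof -
  have "m dvd a - b" using assms(3) by (metis add_diff_cancel_left mod_eq_dvd_iff)
  moreover have "\<bar>a - b\<bar> < m" using assms(1,2) by auto
  ultimately show ?thesis
    by (metis abs_dvd_iff dvd_abs_iff eq_iff_diff_eq_0 zdvd_not_zless zero_less_abs_iff)
qed

text \<open>Direct product with addition modulo \<open>m\<close> across groups; addition suffices
  since idempotence is asked only inside the groups. Closed sets pull back along \<open>fst\<close>,
  and a rectangle becomes \<open>R \<times> D\<close>, \<open>C \<times> D\<close>,
  \<open>S \<times> D\<close>.\<close>

lemma good_weight:
  assumes t: "good t" "0 < t" and ext: "extends m w" "0 < m"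
  shows "good (t * m + w)"
proof -
  obtain f where f: "ciq {1..t} f" and cov: "triple_covered {1..t} f"
    using t(1) unfolding good_def by blast
  obtain q where q: "ciq ({0..<int m} <+> {..<w}) q"
    and W: "\<And>i j. i < w \<Longrightarrow> j < w \<Longrightarrow> q (Inr i) (Inr j) \<in> Inr ` {..<w}"
    using ext(1) unfolding extends_def by blast
  define D where "D = {0..<int m}"
  define h where "h u v = (f (fst u) (fst v), (snd u + snd v) mod int m)" for u v :: "nat \<times> int"
  have modD: "a mod int m \<in> D" for a using ext(2) by (simp add: D_def)
  interpret frame "{1..t}" D "{..<w}" h q
  proof
    fix x y z assume xyz: "x \<in> {1..t} \<times> D" "y \<in> {1..t} \<times> D" "z \<in> {1..t} \<times> D"
    then have f1: "fst x \<in> {1..t}" "fst y \<in> {1..t}" "fst z \<in> {1..t}"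
      and s1: "snd x \<in> D" "snd y \<in> D" "snd z \<in> D" by (auto simp: mem_Times_iff)
    show "y = z" if "h x y = h x z"
    proof -
      have "fst y = fst z" using that ciq_cancel[OF f f1] by (simp add: h_def)
      moreover have "snd y = snd z"
        using that s1 add_mod_cancel unfolding h_def D_def by (metis prod.inject)
      ultimately show ?thesis by (simp add: prod_eq_iff)
    qed
  next
    fix x y assume xy: "x \<in> {1..t} \<times> D" "y \<in> {1..t} \<times> D" and ne: "fst x \<noteq> fst y"
    then have f1: "fst x \<in> {1..t}" "fst y \<in> {1..t}" by (auto simp: mem_Times_iff)
    show "h x y \<in> {1..t} \<times> D" using ciq_closed[OF f f1] modD by (simp add: h_def)
    show "fst (h x y) \<noteq> fst x"
      using ciq_cancel[OF f f1(1,2,1)] ciq_idem[OF f f1(1)] ne by (auto simp: h_def)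
    show "h x y = h y x" using ciq_comm[OF f f1] by (simp add: h_def add.commute)
  qed (use q W in \<open>auto simp: D_def\<close>)
  have ne: "{1..t} \<noteq> {}" "D \<noteq> {}" using t(2) ext(2) by (auto simp: D_def)
  have "triple_covered X (fill h q)"
  proof (rule triple_covered_fill[OF ne])
    fix x y z assume "x \<in> {1..t} \<times> D" "y \<in> {1..t} \<times> D" "z \<in> {1..t} \<times> D"
    then have f1: "fst x \<in> {1..t}" "fst y \<in> {1..t}" "fst z \<in> {1..t}"
      and s1: "snd x \<in> D" "snd y \<in> D" "snd z \<in> D" by (auto simp: mem_Times_iff)
    from cov f1 show "(\<exists>B. B \<subset> {1..t} \<and> fst x \<in> B \<and> fst y \<in> B \<and> fst z \<in> B \<and>
         (\<forall>u \<in> B \<times> D. \<forall>v \<in> B \<times> D. fst u \<noteq> fst v \<longrightarrow> fst (h u v) \<in> B)) \<or>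
      (\<exists>R C S. R \<subseteq> {1..t} \<times> D \<and> C \<subseteq> {1..t} \<times> D \<and> fst ` R \<inter> fst ` C = {} \<and> card R = card C \<and>
         card S = card R \<and> (\<forall>u\<in>R. \<forall>v\<in>C. h u v \<in> S) \<and> x \<in> R \<and> y \<in> C \<and> z \<in> S)"
    proof (cases rule: triple_coveredE)
      case (closed B)
      then have "\<forall>u \<in> B \<times> D. \<forall>v \<in> B \<times> D. fst (h u v) \<in> B" by (auto simp: h_def)
      then show ?thesis using closed(1,3-5) by (intro disjI1 exI[of _ B]) simp
    next
      case (rect R C S)
      have "R \<times> D \<subseteq> {1..t} \<times> D" "C \<times> D \<subseteq> {1..t} \<times> D" "fst ` (R \<times> D) \<inter> fst ` (C \<times> D) = {}"
        using rect by auto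
      moreover have "card (R \<times> D) = card (C \<times> D)" "card (S \<times> D) = card (R \<times> D)"
        using rect by (simp_all add: card_cartesian_product)
      moreover have "\<forall>u\<in>R \<times> D. \<forall>v\<in>C \<times> D. h u v \<in> S \<times> D"
        using rect(6) modD by (auto simp: h_def)
      moreover have "x \<in> R \<times> D" "y \<in> C \<times> D" "z \<in> S \<times> D"
        using rect s1 by (simp_all add: mem_Times_iff)
      ultimately show ?thesis
        by (intro disjI2 exI[of _ "R \<times> D"] exI[of _ "C \<times> D"] exI[of _ "S \<times> D"]) simp
    qed
  qed
  moreover have "card X = t * m + w" using card_X by (simp add: D_def)
  ultimately show ?thesis using goodI ciq_fill[OF ne(1)] by blast
qed

section \<open>Extensions from starters\<close>

text \<open>For odd \<open>w\<close> the factor \<open>(w + 1) div 2\<close> inverts 2 modulo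
  \<open>w\<close>: the operation is the mean of \<open>i\<close> and \<open>j\<close>.\<close>

lemma ciq_half:
  fixes w :: nat
  assumes "odd w"
  shows "ciq {..<w} (\<lambda>i j. (i + j) * ((w + 1) div 2) mod w)"
proof (rule ciqI)
  define h where "h = (w + 1) div 2"
  have h: "2 * h = w + 1" using assms unfolding h_def by auto
  have w: "0 < w" using assms by (simp add: odd_pos)
  show "(x + x) * ((w + 1) div 2) mod w = x" if "x \<in> {..<w}" for x
  proof -
    have "(x + x) * h = x + x * w"
      using h by (metis add.commute mult.commute mult_2 mult.assoc mult_Suc_right Suc_eq_plus1)
    then show ?thesis using that by (simp add: h_def)
  qed
  show "y = z" if "x \<in> {..<w}" "y \<in> {..<w}" "z \<in> {..<w}"
    "(x + y) * ((w + 1) div 2) mod w = (x + z) * ((w + 1) div 2) mod w" for x y z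
  proof -
    have "2 * ((x + y) * h) mod w = 2 * ((x + z) * h) mod w"
      using that(4) unfolding h_def by (metis mod_mult_right_eq)
    moreover have "2 * ((x + u) * h) = (x + u) + (x + u) * w" for u
      using h by (metis add.commute mult.commute mult.left_commute mult_Suc_right Suc_eq_plus1)
    ultimately have "(x + y) mod w = (x + z) mod w" by simp
    then have "int w dvd int y - int z"
      by (metis add_diff_cancel_left mod_eq_dvd_iff of_nat_add of_nat_mod)
    moreover have "\<bar>int y - int z\<bar> < int w" using that by auto
    ultimately show ?thesis
      by (metis abs_dvd_iff dvd_abs_iff eq_iff_diff_eq_0 of_nat_eq_iff zdvd_not_zless zero_less_abs_iff)
  qed
  show "(x + y) * ((w + 1) div 2) mod w \<in> {..<w}" for x y using w by simp
  show "(x + y) * ((w + 1) div 2) mod w = (y + x) * ((w + 1) div 2) mod w" for x y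
    by (simp only: add.commute)
qed simp

lemma extends_0:
  assumes "odd m"
  shows "extends m 0"
proof -
  define q :: "int + nat \<Rightarrow> int + nat \<Rightarrow> int + nat" where
    "q u v = Inl (int ((nat (projl u) + nat (projl v)) * ((m + 1) div 2) mod m))" for u v
  note half = ciq_half[OF assms]
  have "ciq ({0..<int m} <+> {..<0}) q"
  proof (rule ciqI)
    fix u v z :: "int + nat"
    assume "u \<in> {0..<int m} <+> {..<0}" "v \<in> {0..<int m} <+> {..<0}" "z \<in> {0..<int m} <+> {..<0}"
    then obtain a b c where abc: "u = Inl (int a)" "v = Inl (int b)" "z = Inl (int c)"
        "a \<in> {..<m}" "b \<in> {..<m}" "c \<in> {..<m}"
      by (auto elim!: PlusE) (metis lessThan_iff nat_0_le nat_less_iff)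
    show "v = z" if "q u v = q u z"
      using ciq_cancel[OF half abc(4-6)] that abc by (simp add: q_def)
  next
    fix u v :: "int + nat"
    assume "u \<in> {0..<int m} <+> {..<0}" "v \<in> {0..<int m} <+> {..<0}"
    then obtain a b where ab: "u = Inl (int a)" "v = Inl (int b)" "a \<in> {..<m}" "b \<in> {..<m}"
      by (auto elim!: PlusE) (metis lessThan_iff nat_0_le nat_less_iff)
    show "q u v = q v u" by (simp add: q_def add.commute)
    show "q u v \<in> {0..<int m} <+> {..<0}"
      using ciq_closed[OF half ab(3,4)] ab by (auto simp: q_def)
  next
    fix u :: "int + nat"
    assume "u \<in> {0..<int m} <+> {..<0}"
    then obtain a where a: "u = Inl (int a)" "a \<in> {..<m}"
      by (auto elim!: PlusE) (metis lessThan_iff nat_0_le nat_less_iff)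
    then show "q u u = u" using ciq_idem[OF half a(2)] by (simp add: q_def)
  qed auto
  then show ?thesis unfolding extends_def by blast
qed

lemma sub_mod_cancel:
  fixes m :: int
  assumes "a \<in> {0..<m}" "b \<in> {0..<m}" "(c - a) mod m = (c - b) mod m"
  shows "a = b"
proof -
  have "(c + (m - a)) mod m = (c + (m - b)) mod m"
    using assms(3) by (metis add_diff_eq add.commute mod_add_self1)
  then have "m dvd a - b" by (simp add: mod_eq_dvd_iff) (metis dvd_minus_iff minus_diff_eq)
  moreover have "\<bar>a - b\<bar> < m" using assms(1,2) by auto
  ultimately show ?thesis
    by (metis abs_dvd_iff dvd_abs_iff eq_iff_diff_eq_0 zdvd_not_zless zero_less_abs_iff)
qed

text \<open>The products \<open>s + t\<close>, \<open>s + \<tau> t\<close> \<open>\<mapsto>\<close> \<open>s\<close> exhaust the pairs whose difference is \<open>\<tau> t - t\<close> for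
  some \<open>t \<in> T\<close>; all other pairs are distributed over the \<open>w\<close> matchings \<open>\<mu> i\<close>.\<close>
lemma extends_starter:
  fixes m w :: nat and T :: "int set" and \<tau> :: "int \<Rightarrow> int" and \<mu> :: "nat \<Rightarrow> int \<Rightarrow> int"
  assumes w: "odd w" "card T + w + 1 = m" and T: "T \<subseteq> {1..<int m}"
    and \<tau>: "\<And>t. t \<in> T \<Longrightarrow> \<tau> t \<in> T \<and> \<tau> (\<tau> t) = t"
    and inj: "inj_on (\<lambda>t. (\<tau> t - t) mod int m) T"
    and \<mu>: "\<And>i x. \<lbrakk>i < w; x \<in> {0..<int m}\<rbrakk> \<Longrightarrow> \<mu> i (\<mu> i x) = x"
    and surj: "\<And>x y. \<lbrakk>x \<in> {0..<int m}; y \<in> {0..<int m}; x \<noteq> y;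
        \<forall>t\<in>T. (\<tau> t - t) mod int m \<noteq> (y - x) mod int m\<rbrakk>
      \<Longrightarrow> \<exists>i<w. \<mu> i x = y"
  shows "extends m w"
proof -
  define D where "D = {0..<int m}"
  define \<delta> where "\<delta> t = (\<tau> t - t) mod int m" for t
  define hit where "hit x y \<longleftrightarrow> (y - x) mod int m \<in> \<delta> ` T" for x y
  define lab where "lab x y = the_inv_into T \<delta> ((y - x) mod int m)" for x y
  define col where "col x y = (SOME i. i < w \<and> \<mu> i x = y)" for x y
  have m: "0 < m" using w by simp
  have inj': "inj_on \<delta> T" using inj unfolding \<delta>_def .
  have modD: "a mod int m \<in> D" for a using m by (simp add: D_def)
  have lab: "lab x y \<in> T \<and> \<delta> (lab x y) = (y - x) mod int m" if "hit x y" for x y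
    using that inj' unfolding hit_def lab_def
    by (metis f_the_inv_into_f subset_refl the_inv_into_into)
  \<comment> \<open>Exchanging the two ends of a pair of the starter negates its difference; this is
    what makes the product commutative.\<close>
  have \<delta>_\<tau>: "\<delta> (\<tau> t) = (- \<delta> t) mod int m" if "t \<in> T" for t
    using \<tau>[OF that] unfolding \<delta>_def by (simp add: mod_minus_eq)
  have swap: "hit y x \<and> lab y x = \<tau> (lab x y)" if "hit x y" for x y
  proof -
    have "\<delta> (\<tau> (lab x y)) = (x - y) mod int m"
      using \<delta>_\<tau> lab[OF that] by (metis minus_diff_eq mod_minus_eq)
    then show ?thesis
      using \<tau> lab[OF that] the_inv_into_f_f[OF inj'] unfolding hit_def lab_def by (metis imageI)
  qed
  have col: "col x y < w \<and> \<mu> (col x y) x = y" if "x \<in> D" "y \<in> D" "x \<noteq> y" "\<not> hit x y" for x y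
  proof -
    have "\<forall>t\<in>T. (\<tau> t - t) mod int m \<noteq> (y - x) mod int m"
      using that(4) unfolding hit_def \<delta>_def image_iff by metis
    then have "\<exists>i<w. \<mu> i x = y" using surj[of x y] that(1-3) unfolding D_def by simp
    then show ?thesis unfolding col_def by (rule someI_ex)
  qed
  \<comment> \<open>As \<open>\<mu> i\<close> is an involution, the predicates for
    \<open>(x, y)\<close> and \<open>(y, x)\<close> coincide, so \<open>SOME\<close> returns the
    same index.\<close>
  have col_swap: "col x y = col y x" if "x \<in> D" "y \<in> D" for x y
  proof -
    have "i < w \<and> \<mu> i x = y \<longleftrightarrow> i < w \<and> \<mu> i y = x" for i
      using \<mu>[of i x] \<mu>[of i y] that unfolding D_def by metis
    then show ?thesis unfolding col_def by simp
  qed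
  have "finite T" using T finite_subset by blast
  \<comment> \<open>The nonzero residues outside \<open>T\<close> become the offsets
    \<open>\<nu> j\<close> of the products with \<open>W\<close>. Thus 0, \<open>T\<close> and the
    \<open>\<nu> j\<close> exhaust the residues, and row \<open>x\<close> attains every value in
    \<open>D\<close> once.\<close>
  then have "card ({1..<int m} - T) = w" using T w(2) by (simp add: card_Diff_subset)
  then obtain \<nu> where \<nu>: "bij_betw \<nu> {..<w} ({1..<int m} - T)"
    by (metis bij_betw_iff_card card_lessThan finite_Diff finite_atLeastLessThan_int finite_lessThan)
  have \<nu>T: "\<nu> i \<in> {1..<int m} - T" if "i < w" for i using \<nu> that by (metis bij_betw_apply lessThan_iff)
  define half where "half i j = (i + j) * ((w + 1) div 2) mod w" for i j
  have half: "ciq {..<w} half" unfolding half_def using w(1) by (rule ciq_half)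
  define q where "q u v = (case u of
      Inl x \<Rightarrow> (case v of
          Inl y \<Rightarrow> if x = y then Inl x else if hit x y then Inl ((x - lab x y) mod int m) else Inr (col x y)
        | Inr j \<Rightarrow> Inl ((x - \<nu> j) mod int m))
    | Inr i \<Rightarrow> (case v of Inl y \<Rightarrow> Inl ((y - \<nu> i) mod int m) | Inr j \<Rightarrow> Inr (half i j)))" for u v
  text \<open>In row \<open>x\<close> the entry from \<open>D\<close> in column \<open>v\<close> is \<open>x - off x v\<close>.\<close>
  define off where "off x v = (case v of Inl y \<Rightarrow> if x = y then 0 else lab x y | Inr j \<Rightarrow> \<nu> j)" for x v
  have off: "off x v \<in> {0..<int m}" if "v \<in> D <+> {..<w}" "case v of Inl y \<Rightarrow> x = y \<or> hit x y | Inr _ \<Rightarrow> True" for x v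
  proof (cases v)
    case (Inl y)
    have "lab x y \<in> {0..<int m}" if "hit x y" using lab[OF that] T by auto
    then show ?thesis using that m Inl by (auto simp: off_def)
  next
    case (Inr j)
    then show ?thesis using that \<nu>T[of j] by (auto simp: off_def)
  qed
  have q_row: "q (Inl x) v = Inl ((x - off x v) mod int m)"
    if "x \<in> D" "case v of Inl y \<Rightarrow> x = y \<or> hit x y | Inr _ \<Rightarrow> True" for x v
    using that by (auto simp: q_def off_def D_def split: sum.splits)
  have q_row': "q (Inl x) (Inl y) = Inr (col x y)" if "x \<noteq> y" "\<not> hit x y" for x y
    using that by (simp add: q_def)
  have off_inj: "v = v'" if x: "x \<in> D" and v: "v \<in> D <+> {..<w}" "case v of Inl y \<Rightarrow> x = y \<or> hit x y | Inr _ \<Rightarrow> True"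
    and v': "v' \<in> D <+> {..<w}" "case v' of Inl y \<Rightarrow> x = y \<or> hit x y | Inr _ \<Rightarrow> True"
    and eq: "off x v = off x v'" for x v v'
  proof -
    have T0: "0 \<notin> T" using T by auto
    have \<nu>0: "\<nu> i \<noteq> 0" "\<nu> i \<notin> T" if "i < w" for i using \<nu>T[OF that] by auto
    have labT: "lab x y \<in> T" if "hit x y" for y using lab[OF that] by simp
    show ?thesis
    proof (cases v)
      case v1: (Inl y)
      show ?thesis
      proof (cases v')
        case v2: (Inl y')
        show ?thesis
        proof (cases "x = y \<or> x = y'")
          case True
          have "hit x y \<Longrightarrow> lab x y \<noteq> 0" "hit x y' \<Longrightarrow> lab x y' \<noteq> 0" using labT T0 by metis+
          then show ?thesis using True eq v(2) v'(2) v1 v2 by (auto simp: off_def split: if_splits)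
        next
          case False
          then have "(y - x) mod int m = (y' - x) mod int m"
            using eq v v' v1 v2 lab by (simp add: off_def) metis
          then have "y = y'"
            using v(1) v'(1) v1 v2 add_mod_cancel[of y "int m" y' "-x"] by (auto simp: D_def)
          then show ?thesis using v1 v2 by simp
        qed
      next
        case (Inr j)
        then have "\<nu> j \<noteq> 0" "hit x y \<Longrightarrow> lab x y \<noteq> \<nu> j" using v'(1) labT[of y] \<nu>0[of j] by auto
        then show ?thesis using eq v(2) v1 Inr by (auto simp: off_def split: if_splits)
      qed
    next
      case v1: (Inr i)
      show ?thesis
      proof (cases v')
        case (Inl y)
        have "\<nu> i \<noteq> 0" "hit x y \<Longrightarrow> lab x y \<noteq> \<nu> i" using v(1) v1 labT[of y] \<nu>0[of i] by auto
        then show ?thesis using eq v'(2) v1 Inl by (auto simp: off_def split: if_splits)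
      next
        case (Inr j)
        then have "\<nu> i = \<nu> j" "i < w" "j < w" using eq v v' v1 by (auto simp: off_def)
        then have "i = j" using \<nu> by (metis bij_betw_imp_inj_on inj_onD lessThan_iff)
        then show ?thesis using v1 Inr by simp
      qed
    qed
  qed
  have "ciq (D <+> {..<w}) q"
  proof (rule ciqI)
    show "finite (D <+> {..<w})" by (simp add: D_def)
    show "q u u = u" if "u \<in> D <+> {..<w}" for u
      using that ciq_idem[OF half] by (auto simp: q_def)
    show "q u v \<in> D <+> {..<w}" if "u \<in> D <+> {..<w}" "v \<in> D <+> {..<w}" for u v
      using that modD ciq_closed[OF half] col by (auto simp: q_def)
    show "q u v = q v u" if "u \<in> D <+> {..<w}" "v \<in> D <+> {..<w}" for u v
    proof -
      have eq: "(x - lab x y) mod int m = (y - lab y x) mod int m" if "hit x y" for x y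
      proof -
        have "(\<tau> (lab x y) - lab x y) mod int m = (y - x) mod int m" using lab[OF that] by (simp add: \<delta>_def)
        then have "int m dvd (\<tau> (lab x y) - lab x y) - (y - x)" by (simp add: mod_eq_dvd_iff)
        then have "int m dvd (x - lab x y) - (y - \<tau> (lab x y))" by (simp add: algebra_simps)
        then show ?thesis using swap[OF that] by (simp add: mod_eq_dvd_iff)
      qed
      have hit: "hit x y \<longleftrightarrow> hit y x" for x y using swap by blast
      show ?thesis
      proof (cases u)
        case u: (Inl x)
        then show ?thesis using that hit[of x] eq[of x] col_swap[of x] by (cases v) (auto simp: q_def)
      next
        case (Inr i)
        then show ?thesis using that ciq_comm[OF half, of i] by (cases v) (auto simp: q_def)
      qed
    qed
    show "v = v'" if u: "u \<in> D <+> {..<w}" and v: "v \<in> D <+> {..<w}" and v': "v' \<in> D <+> {..<w}"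
      and eq: "q u v = q u v'" for u v v'
    proof (cases u)
      case (Inl x)
      then have x: "x \<in> D" using u by auto
      define A where "A v \<longleftrightarrow> (case v of Inl y \<Rightarrow> x = y \<or> hit x y | Inr (_::nat) \<Rightarrow> True)" for v
      have isl: "isl (q (Inl x) v) \<longleftrightarrow> A v" for v by (auto simp: q_def A_def split: sum.splits)
      have AA: "A v = A v'" using isl[of v] isl[of v'] eq Inl by simp
      show ?thesis
      proof (cases "A v")
        case True
        then have "A v'" using AA by simp
        then have "(x - off x v) mod int m = (x - off x v') mod int m"
          using True eq q_row[OF x] Inl unfolding A_def by simp
        then have "off x v = off x v'"
          by (rule sub_mod_cancel[OF off[OF v True[unfolded A_def]] off[OF v' \<open>A v'\<close>[unfolded A_def]]])
        then show ?thesis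
          by (rule off_inj[OF x v True[unfolded A_def] v' \<open>A v'\<close>[unfolded A_def]])
      next
        case False
        then have "\<not> A v'" using AA by simp
        obtain y where y: "v = Inl y" "x \<noteq> y" "\<not> hit x y" "y \<in> D"
          using False v by (auto simp: A_def split: sum.splits)
        obtain y' where y': "v' = Inl y'" "x \<noteq> y'" "\<not> hit x y'" "y' \<in> D"
          using \<open>\<not> A v'\<close> v' by (auto simp: A_def split: sum.splits)
        have "col x y = col x y'" using eq Inl y y' by (simp add: q_row')
        then have "y = y'" using col[OF x] y y' by metis
        then show ?thesis using y y' by simp
      qed
    next
      case (Inr i)
      then have i: "i < w" using u by auto
      show ?thesis
      proof (cases v)
        case v1: (Inl y)
        then obtain y' where v2: "v' = Inl y'" using eq Inr by (cases v') (auto simp: q_def)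
        have "(- \<nu> i + y) mod int m = (- \<nu> i + y') mod int m" using eq Inr v1 v2 by (simp add: q_def)
        then have "y = y'" using v v' v1 v2 by (intro add_mod_cancel[of y "int m" y' "- \<nu> i"]) (auto simp: D_def)
        then show ?thesis using v1 v2 by simp
      next
        case v1: (Inr j)
        then obtain j' where v2: "v' = Inr j'" using eq Inr by (cases v') (auto simp: q_def)
        have "half i j = half i j'" using eq Inr v1 v2 by (simp add: q_def)
        then show ?thesis using ciq_cancel[OF half, of i j j'] i v v' v1 v2 by auto
      qed
    qed
  qed
  moreover have "q (Inr i) (Inr j) \<in> Inr ` {..<w}" if "i < w" "j < w" for i j
    using ciq_closed[OF half, of i j] that by (simp add: q_def)
  ultimately show ?thesis unfolding extends_def D_def by (intro exI[of _ q]) simp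
qed

lemma extends_starter_odd:
  fixes m w :: nat and T :: "int set" and \<tau> :: "int \<Rightarrow> int"
  assumes w: "odd w" "card T + w + 1 = m" and m: "even m" and T: "T \<subseteq> {1..<int m}"
    and \<tau>: "\<And>t. t \<in> T \<Longrightarrow> \<tau> t \<in> T \<and> \<tau> (\<tau> t) = t \<and> \<tau> t \<noteq> t"
    and inj: "inj_on (\<lambda>t. (\<tau> t - t) mod int m) T"
    and rest: "\<And>d. d \<in> {1..<int m} - (\<lambda>t. (\<tau> t - t) mod int m) ` T \<Longrightarrow> odd d \<or> 2 * d = int m"
  shows "extends m w"
proof -
  define \<delta> where "\<delta> t = (\<tau> t - t) mod int m" for t
  define I where "I = {1..<int m} - \<delta> ` T"
  have m0: "0 < m" using w by simp
  have even_mod: "even (a mod int m) \<longleftrightarrow> even a" for a using m by (metis dvd_mod_iff even_of_nat)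
  have \<delta>0: "\<delta> t \<in> {1..<int m}" if "t \<in> T" for t
  proof -
    have "\<delta> t \<noteq> 0"
    proof
      assume "\<delta> t = 0"
      then have "int m dvd \<tau> t - t" by (simp add: \<delta>_def mod_eq_0_iff_dvd)
      moreover have "t \<in> {1..<int m}" "\<tau> t \<in> {1..<int m}" using T \<tau>[OF that] that by auto
      moreover from this have "\<bar>\<tau> t - t\<bar> < int m" by auto
      ultimately have "\<tau> t = t"
        by (metis abs_dvd_iff dvd_abs_iff eq_iff_diff_eq_0 zdvd_not_zless zero_less_abs_iff)
      then show False using \<tau>[OF that] by simp
    qed
    moreover have "0 \<le> \<delta> t" "\<delta> t < int m" using m0 by (simp_all add: \<delta>_def)
    ultimately show ?thesis by simp
  qed
  have "finite T" using T finite_subset by blast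
  moreover have "card (\<delta> ` T) = card T" using inj by (simp add: card_image \<delta>_def)
  moreover have "\<delta> ` T \<subseteq> {1..<int m}" using \<delta>0 by blast
  ultimately have "card I = w" using w(2) unfolding I_def by (simp add: card_Diff_subset)
  then obtain \<sigma> where \<sigma>: "bij_betw \<sigma> {..<w} I"
    by (metis I_def bij_betw_iff_card card_lessThan finite_Diff finite_atLeastLessThan_int finite_lessThan)
  have \<sigma>I: "\<sigma> i \<in> I" if "i < w" for i using \<sigma> that by (metis bij_betw_apply lessThan_iff)
  define \<mu> where "\<mu> i x = (if even x \<or> even (\<sigma> i) then (x + \<sigma> i) mod int m else (x - \<sigma> i) mod int m)" for i x
  show ?thesis
  proof (rule extends_starter[OF w T _ inj])
    show "\<tau> t \<in> T \<and> \<tau> (\<tau> t) = t" if "t \<in> T" for t using \<tau>[OF that] by simp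
    show "\<mu> i (\<mu> i x) = x" if i: "i < w" and x: "x \<in> {0..<int m}" for i x
    proof (cases "even (\<sigma> i)")
      case True
      then have "2 * \<sigma> i = int m" using rest \<sigma>I[OF i] unfolding I_def \<delta>_def by blast
      then have "\<sigma> i + \<sigma> i = int m" by simp
      then have "x + \<sigma> i + \<sigma> i = x + int m" by linarith
      then have "\<mu> i (\<mu> i x) = (x + int m) mod int m" using True by (simp add: \<mu>_def mod_add_left_eq)
      then show ?thesis using x by simp
    next
      case False
      then have "\<mu> i (\<mu> i x) = x mod int m"
        by (simp add: \<mu>_def even_mod mod_add_left_eq mod_diff_left_eq)
      then show ?thesis using x by simp
    qed
    show "\<exists>i<w. \<mu> i x = y"
      if x: "x \<in> {0..<int m}" and y: "y \<in> {0..<int m}" and ne: "x \<noteq> y"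
        and d: "\<forall>t\<in>T. (\<tau> t - t) mod int m \<noteq> (y - x) mod int m" for x y
    proof -
      have rng: "a mod int m \<in> {1..<int m}" if "a = y - x \<or> a = x - y" for a
      proof -
        have "\<not> int m dvd y - x"
        proof
          assume "int m dvd y - x"
          moreover have "\<bar>y - x\<bar> < int m" using x y by auto
          ultimately show False using ne
            by (metis abs_dvd_iff dvd_abs_iff eq_iff_diff_eq_0 zdvd_not_zless zero_less_abs_iff)
        qed
        then have "a mod int m \<noteq> 0" using that by (metis dvd_minus_iff minus_diff_eq mod_eq_0_iff_dvd)
        moreover have "0 \<le> a mod int m" "a mod int m < int m" using m0 by simp_all
        ultimately show ?thesis by simp
      qed
      have 1: "(y - x) mod int m \<in> I"
        using rng[of "y - x"] d unfolding I_def \<delta>_def by (auto simp: image_iff)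
      have 2: "(x - y) mod int m \<in> I"
      proof -
        have "(x - y) mod int m \<noteq> \<delta> t" if t: "t \<in> T" for t
        proof
          assume "(x - y) mod int m = \<delta> t"
          then have "(t - \<tau> t) mod int m = (y - x) mod int m"
            unfolding \<delta>_def by (metis minus_diff_eq mod_minus_eq)
          then show False using d \<tau>[OF t] by metis
        qed
        then show ?thesis using rng[of "x - y"] unfolding I_def by (auto simp: image_iff)
      qed
      show ?thesis
      proof (cases "even x \<or> even ((y - x) mod int m)")
        case True
        obtain i where "i < w" "\<sigma> i = (y - x) mod int m"
          using 1 \<sigma> by (metis bij_betw_iff_bijections lessThan_iff)
        moreover from this have "\<mu> i x = y" using True y by (auto simp: \<mu>_def mod_add_right_eq)
        ultimately show ?thesis by blast
      next
        case False
        obtain i where "i < w" "\<sigma> i = (x - y) mod int m"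
          using 2 \<sigma> by (metis bij_betw_iff_bijections lessThan_iff)
        moreover from this have "\<mu> i x = y" using False y by (auto simp: \<mu>_def mod_diff_right_eq even_mod)
        ultimately show ?thesis by blast
      qed
    qed
  qed
qed

text \<open>The pairs \<open>{t, -t}\<close> of \<open>T1\<close> have all even differences except 0 and possibly \<open>k\<close>, the pairs
  \<open>{t, 1 - t}\<close> of \<open>T2\<close> have as many odd differences as needed.\<close>
lemma extends_even:
  assumes w: "odd w" "w + 2 * ((k - 1) div 2) < 2 * k"
  shows "extends (2 * k) w"
proof -
  define a where "a = (int k - 1) div 2"
  \<comment> \<open>Solves 2 a + 2 b + w + 1 = 2 k, the size required of a starter; the bound on
    \<open>w\<close> says that \<open>b\<close> is not negative. \<open>T1\<close> surrounds 0 and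
    \<open>T2\<close> surrounds \<open>k + 1/2\<close> modulo \<open>2 k\<close>, so they stay
    disjoint.\<close>
  define b where "b = (2 * int k - 1 - 2 * a - int w) div 2"
  define T1 where "T1 = {1..a} \<union> {2 * int k - a..2 * int k - 1}"
  define T2 where "T2 = {int k + 1 - b..int k + b}"
  define \<tau> where "\<tau> t = (if t \<in> T2 then 2 * int k + 1 - t else 2 * int k - t)" for t
  have k: "0 < k" using w by (cases k) auto
  have a: "2 * a \<le> int k - 1" "int k - 2 \<le> 2 * a" "0 \<le> a" using k unfolding a_def by linarith+
  have "int ((k - 1) div 2) = a" using k unfolding a_def by (simp add: zdiv_int of_nat_diff)
  then have "int w + 2 * a < 2 * int k" using w(2) by linarith
  moreover have "even (2 * int k - 1 - 2 * a - int w)" using w(1) by simp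
  ultimately have b: "2 * b = 2 * int k - 1 - 2 * a - int w" "0 \<le> b" unfolding b_def by auto
  have ab: "a + b \<le> int k - 1" "2 * b \<le> int k" using a b odd_pos[OF w(1)] by linarith+
  have disj: "T1 \<inter> T2 = {}" unfolding T1_def T2_def using ab a by auto
  show ?thesis
  proof (rule extends_starter_odd[of w "T1 \<union> T2"])
    have "card T1 = nat a + nat a"
      unfolding T1_def using a by (subst card_Un_disjoint) auto
    moreover have "card T2 = nat (2 * b)" unfolding T2_def by simp
    moreover have "finite T1" "finite T2" unfolding T1_def T2_def by auto
    ultimately have "card (T1 \<union> T2) = nat a + nat a + nat (2 * b)" using disj by (simp add: card_Un_disjoint)
    then show "card (T1 \<union> T2) + w + 1 = 2 * k" using a b by linarith
    show "T1 \<union> T2 \<subseteq> {1..<int (2 * k)}" using a b ab unfolding T1_def T2_def by auto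
    show "\<tau> t \<in> T1 \<union> T2 \<and> \<tau> (\<tau> t) = t \<and> \<tau> t \<noteq> t" if "t \<in> T1 \<union> T2" for t
    proof (cases "t \<in> T2")
      case True
      then have "2 * int k + 1 - t \<in> T2" unfolding T2_def by auto
      moreover have "2 * int k + 1 - t \<noteq> t" by presburger
      ultimately show ?thesis using True by (simp add: \<tau>_def)
    next
      case False
      then have "t \<in> T1" using that by simp
      then have "2 * int k - t \<in> T1" "2 * int k - t \<noteq> t" using a unfolding T1_def by auto
      then show ?thesis using False disj by (auto simp: \<tau>_def)
    qed
    show "inj_on (\<lambda>t. (\<tau> t - t) mod int (2 * k)) (T1 \<union> T2)"
    proof (rule inj_onI)
      fix s t assume st: "s \<in> T1 \<union> T2" "t \<in> T1 \<union> T2"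
        and "(\<tau> s - s) mod int (2 * k) = (\<tau> t - t) mod int (2 * k)"
      then have dvd: "2 * int k dvd (\<tau> s - s) - (\<tau> t - t)" by (simp add: mod_eq_dvd_iff)
      then have "even ((\<tau> s - s) - (\<tau> t - t))" by (rule dvd_trans[rotated]) simp
      then have same: "s \<in> T2 \<longleftrightarrow> t \<in> T2" by (auto simp: \<tau>_def split: if_splits)
      have "(\<tau> s - s) - (\<tau> t - t) = 2 * (t - s)" using same by (auto simp: \<tau>_def)
      then have "2 * int k dvd 2 * (t - s)" using dvd by (simp only:)
      \<comment> \<open>Parity has told the differences of \<open>T1\<close> from those of
        \<open>T2\<close>; within either set only a shift by \<open>k\<close> could collide. It is
        excluded because 2 a < k and because \<open>T2\<close> is an interval of at most
        \<open>k\<close> residues.\<close>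
      then have "int k dvd t - s" by (simp only: dvd_mult_cancel_left) simp
      then obtain j where j: "t - s = int k * j" ..
      have "\<bar>t - s\<bar> < 2 * int k" using st a b ab unfolding T1_def T2_def by auto
      then have "\<bar>j\<bar> < 2" using j k by (simp add: abs_mult mult.commute)
      then consider "j = 0" | "j = 1" | "j = -1" by linarith
      then show "s = t"
      proof cases
        case 1
        then show ?thesis using j by simp
      next
        case 2
        then have "t = s + int k" using j by simp
        then show ?thesis using st same a b ab unfolding T1_def T2_def by auto
      next
        case 3
        then have "s = t + int k" using j by simp
        then show ?thesis using st same a b ab unfolding T1_def T2_def by auto
      qed
    qed
    show "odd d \<or> 2 * d = int (2 * k)"
      if d: "d \<in> {1..<int (2 * k)} - (\<lambda>t. (\<tau> t - t) mod int (2 * k)) ` (T1 \<union> T2)" for d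
    proof (rule ccontr)
      assume "\<not> (odd d \<or> 2 * d = int (2 * k))"
      then obtain e where e: "d = 2 * e" "2 * e \<noteq> int k" by (auto elim!: evenE)
      then have e1: "1 \<le> e" "e < int k" using d by auto
      \<comment> \<open>The solutions of - 2 t = 2 e modulo 2 k are - e and k - e; one of them is in
        \<open>T1\<close> unless 2 e = k.\<close>
      have "\<exists>t\<in>T1. (2 * int k - t - t) mod (2 * int k) = d"
      proof (cases "e \<le> a")
        case True
        then have "2 * int k - e \<in> T1" using e1 unfolding T1_def by auto
        moreover have "(2 * int k - (2 * int k - e) - (2 * int k - e)) mod (2 * int k) = d"
          using e e1 by (simp add: mod_pos_neg_trivial)
        ultimately show ?thesis by blast
      next
        case False
        then have "int k - e \<in> T1" using e e1 a unfolding T1_def by auto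
        moreover have "(2 * int k - (int k - e) - (int k - e)) mod (2 * int k) = d"
          using e e1 by simp
        ultimately show ?thesis by blast
      qed
      then obtain t where t: "t \<in> T1" "(2 * int k - t - t) mod (2 * int k) = d" by blast
      then have "(\<tau> t - t) mod int (2 * k) = d" using disj by (auto simp: \<tau>_def)
      then show False using d t(1) by blast
    qed
  qed (use w in simp_all)
qed

text \<open>Here \<open>T\<close> is empty, and what is needed is a factorization of the complete
  graph on 6 vertices: the round robin schedule, with 5 as the fixed player and reflections in
  \<open>i\<close> modulo 5.\<close>

lemma extends_6_5: "extends 6 5"
proof -
  define \<mu> :: "nat \<Rightarrow> int \<Rightarrow> int" where
    "\<mu> i x = (if x = 5 then int i else if x = int i then 5 else (2 * int i - x) mod 5)" for i x
  have "\<forall>i\<in>set [0..<5]. \<forall>x\<in>set [0..5]. \<mu> i (\<mu> i x) = x"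
    "\<forall>x\<in>set [0..5]. \<forall>y\<in>set [0..5]. x \<noteq> y \<longrightarrow> (\<exists>i\<in>set [0..<5]. \<mu> i x = y)"
    unfolding \<mu>_def by code_simp+
  then show ?thesis
    by (intro extends_starter[of 5 "{}" 6 id \<mu>]) (auto simp: Bex_def)
qed

text \<open>The differences \<open>\<plusminus>2\<close> and \<open>5\<close> form a prism over a pentagon; its three matchings are the
  last three rows.\<close>
lemma extends_10_7: "extends 10 7"
proof -
  define \<mu> :: "nat \<Rightarrow> int \<Rightarrow> int" where "\<mu> i x =
    [[1, 0, 3, 2, 5, 4, 7, 6, 9, 8], [3, 8, 5, 0, 7, 2, 9, 4, 1, 6],
     [7, 4, 9, 6, 1, 8, 3, 0, 5, 2], [9, 2, 1, 4, 3, 6, 5, 8, 7, 0],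
     [2, 9, 0, 8, 6, 7, 4, 5, 3, 1], [5, 3, 4, 1, 2, 0, 8, 9, 6, 7], [8, 6, 7, 5, 9, 3, 1, 2, 0, 4]]
     ! i ! nat x" for i x
  have 1: "\<forall>i\<in>set [0..<7]. \<forall>x\<in>set [0..9]. \<mu> i (\<mu> i x) = x" unfolding \<mu>_def by code_simp
  have 2: "\<forall>x\<in>set [0..9]. \<forall>y\<in>set [0..9]. x \<noteq> y \<longrightarrow> (y - x) mod 10 \<noteq> 4 \<longrightarrow> (y - x) mod 10 \<noteq> 6 \<longrightarrow>
      (\<exists>i\<in>set [0..<7]. \<mu> i x = y)" unfolding \<mu>_def by code_simp
  show ?thesis
  proof (rule extends_starter[of 7 "{2, 8}" 10 "\<lambda>t. 10 - t" \<mu>])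
    show "\<mu> i (\<mu> i x) = x" if "i < 7" "x \<in> {0..<int 10}" for i x
      using that by (intro 1[rule_format]) auto
    show "\<exists>i<7. \<mu> i x = y" if "x \<in> {0..<int 10}" "y \<in> {0..<int 10}" "x \<noteq> y"
      "\<forall>t\<in>{2, 8}. (10 - t - t) mod int 10 \<noteq> (y - x) mod int 10" for x y
      using that 2[rule_format, of x y] by auto
  qed auto
qed

section \<open>Affine and projective spaces over small fields\<close>

datatype z3 = Z0 | Z1 | Z2

instantiation z3 :: idom
begin

definition "0 = Z0"
definition "1 = Z1"

fun plus_z3 :: "z3 \<Rightarrow> z3 \<Rightarrow> z3" where
  "plus_z3 Z0 y = y" | "plus_z3 x Z0 = x"
| "plus_z3 Z1 Z1 = Z2" | "plus_z3 Z2 Z2 = Z1" | "plus_z3 Z1 Z2 = Z0" | "plus_z3 Z2 Z1 = Z0"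

fun times_z3 :: "z3 \<Rightarrow> z3 \<Rightarrow> z3" where
  "times_z3 Z0 y = Z0" | "times_z3 x Z0 = Z0"
| "times_z3 Z1 Z1 = Z1" | "times_z3 Z2 Z2 = Z1" | "times_z3 Z1 Z2 = Z2" | "times_z3 Z2 Z1 = Z2"

fun uminus_z3 :: "z3 \<Rightarrow> z3" where
  "uminus_z3 Z0 = Z0" | "uminus_z3 Z1 = Z2" | "uminus_z3 Z2 = Z1"

definition minus_z3 :: "z3 \<Rightarrow> z3 \<Rightarrow> z3" where "minus_z3 x y = x + - y"

instance
proof
  fix a b c :: z3
  show "a + b + c = a + (b + c)" by (cases a; cases b; cases c) simp_all
  show "a + b = b + a" by (cases a; cases b) simp_all
  show "0 + a = a" by (simp add: zero_z3_def)
  show "- a + a = 0" by (cases a) (simp_all add: zero_z3_def)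
  show "a - b = a + - b" by (rule minus_z3_def)
  show "a * b * c = a * (b * c)" by (cases a; cases b; cases c) simp_all
  show "a * b = b * a" by (cases a; cases b) simp_all
  show "1 * a = a" by (cases a) (simp_all add: one_z3_def)
  show "(a + b) * c = a * c + b * c" "a * (b + c) = a * b + a * c" by (cases a; cases b; cases c; simp)+
  show "0 * a = 0" "a * 0 = 0" by (cases a; simp add: zero_z3_def)+
  show "(0::z3) \<noteq> 1" by (simp add: zero_z3_def one_z3_def)
  show "a \<noteq> 0 \<Longrightarrow> b \<noteq> 0 \<Longrightarrow> a * b \<noteq> 0" by (cases a; cases b) (simp_all add: zero_z3_def)
qed

end

lemma z3_diff: "x - Z0 = x" "x - Z1 = x + Z2" "x - Z2 = x + Z1"
  by (simp_all only: minus_z3_def uminus_z3.simps) (cases x; simp)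

text \<open>Three elements of \<open>z3\<close> have sum 0 exactly when they are all equal or all
  distinct.\<close>

lemma z3_third: "i \<noteq> j \<Longrightarrow> - i - j \<noteq> (i :: z3)"
  by (cases i; cases j) (simp_all add: z3_diff zero_z3_def)

lemma z3_third_unique: "\<lbrakk>i \<noteq> j; k \<noteq> i; k \<noteq> j\<rbrakk> \<Longrightarrow> k = - i - (j :: z3)"
  by (cases i; cases j; cases k) (simp_all add: z3_diff zero_z3_def)

lemma UNIV_z3: "UNIV = {Z0, Z1, Z2}"
  using z3.exhaust by auto

instance z3 :: finite
  by standard (simp add: UNIV_z3)

lemma card_z3: "CARD(z3) = 3"
  by (simp add: UNIV_z3)

text \<open>Elementary abelian 3-groups. There \<open>x\<close>, \<open>y\<close>,
  \<open>- x - y\<close> are the three points of an affine line when \<open>x\<close> and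
  \<open>y\<close> differ, and the identity gives \<open>- x - x = x\<close>, so the third point
  defines an idempotent operation.\<close>

class exponent3 = ab_group_add +
  assumes add_triple: "x + x + x = 0"

lemma add_self: "x + x = - (x::'a::exponent3)"
  by (simp only: eq_neg_iff_add_eq_0 add_triple)

lemma minus_minus_self: "- x - x = (x::'a::exponent3)"
  by (metis add_self minus_add_distrib minus_minus uminus_add_conv_diff add.commute)

definition coset :: "'a::exponent3 \<Rightarrow> 'a \<Rightarrow> 'a set" where
  "coset x h = {x, x + h, x - h}"

lemma cosetE:
  assumes "y \<in> coset x h"
  obtains u where "u \<in> {0, h, - h}" "y = x + u"
  using assms that[of 0] that[of h] that[of "- h"] by (auto simp: coset_def)

lemma cosetI: "u \<in> {0, h, - h} \<Longrightarrow> x + u \<in> coset x h"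
  by (auto simp: coset_def)

lemma self_in_coset: "x \<in> coset x h"
  by (simp add: coset_def)

lemma coset_eq:
  assumes "y \<in> coset x h"
  shows "coset y h = coset x h"
proof -
  have "x + h + h = x - h" by (simp add: add.assoc add_self)
  moreover have "x - h - h = x + h" by (metis diff_diff_add add_self diff_minus_eq_add)
  ultimately show ?thesis using assms by (auto simp: coset_def)
qed

lemma coset_disjoint:
  assumes "y \<notin> coset x h"
  shows "coset x h \<inter> coset y h = {}"
  using assms coset_eq self_in_coset by blast

text \<open>Cosets of the subgroup generated by \<open>h\<close> are congruence classes of the
  operation \<open>- x - y\<close>; every rectangle over the field with 3 elements rests on
  this.\<close>

lemma coset_closed:
  assumes "a \<in> coset x h" "b \<in> coset y h"
  shows "- a - b \<in> coset (- x - y) h"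
proof -
  obtain u v where uv: "u \<in> {0, h, - h}" "v \<in> {0, h, - h}" "a = x + u" "b = y + v"
    using assms by (auto elim!: cosetE)
  have "- u - v \<in> {0, h, - h}"
    using uv(1,2) add_self[of h] minus_minus_self[of h] by auto
  moreover have "- a - b = - x - y + (- u - v)" using uv by (simp add: algebra_simps)
  ultimately show ?thesis by (metis cosetI)
qed

lemma card_coset:
  assumes "h \<noteq> 0"
  shows "card (coset x h) = 3"
proof -
  have "h \<noteq> - h"
    using assms add_triple[of h] by (metis add.right_inverse add_0)
  moreover from this have "x + h \<noteq> x - h" by (metis add_left_cancel diff_conv_add_uminus)
  ultimately show ?thesis using assms by (simp add: coset_def)
qed

instance z3 :: exponent3
proof
  fix a :: z3
  show "a + a + a = 0" by (cases a) (simp_all add: zero_z3_def)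
qed

instance prod :: (exponent3, exponent3) exponent3
  by standard (simp add: prod_eq_iff add_triple)

lemma UNIV_bit: "(UNIV :: bit set) = {0, 1}"
  by (auto intro: bit.exhaust)

instance bit :: finite
  by standard (simp add: UNIV_bit)

lemma card_bit: "CARD(bit) = 2"
  by (simp add: UNIV_bit)

section \<open>The Fano plane and the affine plane of order 3\<close>

lemma good_7: "good 7"
proof -
  define X :: "(bit \<times> bit \<times> bit) set" where "X = UNIV - {0}"
  have card: "card X = 7" and finX: "finite X"
    unfolding X_def by (simp_all add: card_Diff_subset card_bit)
  have xx: "x + x = 0" for x :: "bit \<times> bit \<times> bit" by (cases x) (simp add: zero_prod_def)
  then have eq: "x + y = 0 \<longleftrightarrow> x = y" for x y :: "bit \<times> bit \<times> bit"
    by (metis add_right_cancel)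
  have canc: "x + (x + y) = y" for x y :: "bit \<times> bit \<times> bit"
    by (metis xx add.assoc add_0)
  define f :: "bit \<times> bit \<times> bit \<Rightarrow> bit \<times> bit \<times> bit \<Rightarrow> bit \<times> bit \<times> bit"
    where "f x y = (if x = y then x else x + y)" for x y
  have q: "ciq X f"
  proof (rule ciqI)
    show "y = z" if "x \<in> X" "y \<in> X" "z \<in> X" "f x y = f x z" for x y z
      using that by (auto simp: f_def X_def split: if_splits)
  qed (auto simp: finX f_def X_def eq add.commute)
  have sub: "{x, y, x + y} \<subset> X \<and> (\<forall>a\<in>{x, y, x + y}. \<forall>b\<in>{x, y, x + y}. f a b \<in> {x, y, x + y})"
    if "x \<in> X" "y \<in> X" "x \<noteq> y" for x y
  proof
    have "card {x, y, x + y} \<le> 3" by (simp add: card_insert_if)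
    then have "{x, y, x + y} \<noteq> X" using card by auto
    then show "{x, y, x + y} \<subset> X" using that by (auto simp: X_def eq)
    show "\<forall>a\<in>{x, y, x + y}. \<forall>b\<in>{x, y, x + y}. f a b \<in> {x, y, x + y}"
      using canc[of x y] canc[of y x] by (auto simp: f_def add.commute)
  qed
  have "triple_covered X f"
    unfolding triple_covered_def
  proof (intro ballI)
    fix r c s assume rcs: "r \<in> X" "c \<in> X" "s \<in> X"
    show "(\<exists>B. B \<subset> X \<and> (\<forall>x\<in>B. \<forall>y\<in>B. f x y \<in> B) \<and> r \<in> B \<and> c \<in> B \<and> s \<in> B) \<or>
     (\<exists>R C S. R \<subseteq> X \<and> C \<subseteq> X \<and> R \<inter> C = {} \<and> card R = card C \<and> card S = card R \<and>
        (\<forall>x\<in>R. \<forall>y\<in>C. f x y \<in> S) \<and> r \<in> R \<and> c \<in> C \<and> s \<in> S)"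
    proof (cases "r = c \<or> s \<in> {r, c, r + c}")
      case True
      \<comment> \<open>A second point that spans with \<open>r\<close> a line through
        \<open>c\<close> and \<open>s\<close>: \<open>c\<close> if it differs from \<open>r\<close>,
        else \<open>s\<close>, and any other point if all three coincide.\<close>
      obtain y where y: "y \<in> X" "y \<noteq> r" "c \<in> {r, y, r + y}" "s \<in> {r, y, r + y}"
      proof (cases "r = c")
        case rc: True
        show ?thesis
        proof (cases "s = r")
          case True
          have "X \<noteq> {r}" using card by auto
          then obtain y where "y \<in> X" "y \<noteq> r" using rcs(1) by blast
          then show ?thesis using that rc True by auto
        qed (use that rc rcs in auto)
      qed (use that True rcs in auto)
      then show ?thesis using sub[OF rcs(1) y(1)] by (intro disjI1 exI[of _ "{r, y, r + y}"]) auto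
    next
      case False
      have s: "s + r \<noteq> c" "s + c \<noteq> r" "s + r \<noteq> s + c" using False canc by (metis add.commute insertCI add_left_cancel)+
      have nz: "s + r \<noteq> 0" "s + c \<noteq> 0" "r \<noteq> 0" "c \<noteq> 0" "s \<noteq> 0" using False rcs eq by (auto simp: X_def)
      have sum: "(s + c) + (s + r) = r + c" "r + (s + r) = s" "(s + c) + c = s"
        using canc by (metis add.commute add.left_commute)+
      have "\<forall>x\<in>{r, s + c}. \<forall>y\<in>{c, s + r}. f x y \<in> {s, r + c}"
        using False s sum nz by (auto simp: f_def)
      moreover have "{r, s + c} \<inter> {c, s + r} = {}" using False s nz by auto
      moreover have "card {r, s + c} = 2" "card {c, s + r} = 2" "card {s, r + c} = 2"
        using False s by (auto simp: card_insert_if)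
      moreover have "{r, s + c} \<subseteq> X" "{c, s + r} \<subseteq> X" using rcs nz by (auto simp: X_def)
      ultimately show ?thesis
        by (intro disjI2 exI[of _ "{r, s + c}"] exI[of _ "{c, s + r}"] exI[of _ "{s, r + c}"]) simp
    qed
  qed
  then show ?thesis by (rule goodI[OF q _ card])
qed

lemma good_9: "good 9"
proof -
  define f :: "z3 \<times> z3 \<Rightarrow> z3 \<times> z3 \<Rightarrow> z3 \<times> z3" where "f x y = - x - y" for x y
  have card9: "CARD(z3 \<times> z3) = 9" by (simp add: card_z3)
  have q: "ciq UNIV f"
    by (rule ciqI) (auto simp: f_def minus_minus_self)
  have "triple_covered UNIV f"
    unfolding triple_covered_def
  proof (intro ballI)
    fix r c s :: "z3 \<times> z3"
    have line: "\<exists>B. B \<subset> UNIV \<and> (\<forall>x\<in>B. \<forall>y\<in>B. f x y \<in> B) \<and> r \<in> B \<and> c \<in> B \<and> s \<in> B"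
      if "c \<in> coset r h" "s \<in> coset r h" for h
    proof (intro exI[of _ "coset r h"] conjI)
      have "card (coset r h) \<le> 3" by (simp add: coset_def card_insert_if)
      then have "coset r h \<noteq> UNIV" using card9 by auto
      then show "coset r h \<subset> UNIV" by blast
      show "\<forall>x\<in>coset r h. \<forall>y\<in>coset r h. f x y \<in> coset r h"
        using coset_closed[of _ r h _ r] by (simp add: f_def minus_minus_self)
    qed (use that in \<open>auto simp: self_in_coset\<close>)
    \<comment> \<open>Chosen so that \<open>- r - c = s - h\<close>: the classes of \<open>r\<close>
      and \<open>c\<close> then multiply into the class of \<open>s\<close>. If \<open>h\<close> is
      0, or \<open>r\<close> and \<open>c\<close> share a class, all three points lie on one line or
      coincide.\<close>
    define h where "h = r + c + s"
    have s: "- r - c \<in> coset s h" by (simp add: coset_def h_def)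
    consider "h = 0" | "c \<in> coset r h" | "h \<noteq> 0" "c \<notin> coset r h" by blast
    then show "(\<exists>B. B \<subset> UNIV \<and> (\<forall>x\<in>B. \<forall>y\<in>B. f x y \<in> B) \<and> r \<in> B \<and> c \<in> B \<and> s \<in> B) \<or>
     (\<exists>R C S. R \<subseteq> UNIV \<and> C \<subseteq> UNIV \<and> R \<inter> C = {} \<and> card R = card C \<and> card S = card R \<and>
        (\<forall>x\<in>R. \<forall>y\<in>C. f x y \<in> S) \<and> r \<in> R \<and> c \<in> C \<and> s \<in> S)"
    proof cases
      case 1
      then have "s = - r - c" by (simp add: h_def add_eq_0_iff)
      also have "\<dots> = r - (c - r)" using add_self[of r] by (simp add: algebra_simps)
      finally have "s \<in> coset r (c - r)" by (simp add: coset_def)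
      moreover have "c \<in> coset r (c - r)" by (simp add: coset_def)
      ultimately show ?thesis by (intro disjI1 line)
    next
      case 2
      then have *: "- r - c \<in> coset r h"
        using coset_closed[OF self_in_coset 2, of r] by (simp add: minus_minus_self)
      then have "s \<in> coset r h" using coset_eq[OF s] coset_eq[OF *] self_in_coset[of s h] by simp
      then show ?thesis using 2 by (intro disjI1 line)
    next
      case 3
      have "\<forall>x\<in>coset r h. \<forall>y\<in>coset c h. f x y \<in> coset s h"
        using coset_closed[of _ r h _ c] coset_eq[OF s] by (simp add: f_def)
      then show ?thesis
        using coset_disjoint[OF 3(2)] card_coset[OF 3(1), of r] card_coset[OF 3(1), of c]
          card_coset[OF 3(1), of s] self_in_coset[of r h] self_in_coset[of c h] self_in_coset[of s h]
        by (intro disjI2 exI[of _ "coset r h"] exI[of _ "coset c h"] exI[of _ "coset s h"]) simp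
    qed
  qed
  then show ?thesis using card9 by (rule goodI[OF q])
qed

section \<open>Nonzero vectors of the space of dimension 3 over the field with 3 elements\<close>

type_synonym vec = "z3 \<times> z3 \<times> z3"

definition dot :: "vec \<Rightarrow> vec \<Rightarrow> z3" where
  "dot u v = (case (u, v) of ((a, b, c), (a', b', c')) \<Rightarrow> a * a' + b * b' + c * c')"

definition cross :: "vec \<Rightarrow> vec \<Rightarrow> vec" where
  "cross u v = (case (u, v) of ((a, b, c), (a', b', c')) \<Rightarrow>
     (b * c' - c * b', c * a' - a * c', a * b' - b * a'))"

lemma dot_add: "dot l (u + v) = dot l u + dot l v"
  and dot_minus: "dot l (- u) = - dot l u"
  and dot_zero: "dot l 0 = 0"
  by (auto simp: dot_def zero_prod_def algebra_simps split: prod.splits)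

lemma dot_diff: "dot l (u - v) = dot l u - dot l v"
  using dot_add[of l u "- v"] by (simp add: dot_minus)

lemma dot_cross: "dot (cross u v) u = 0" "dot (cross u v) v = 0"
  by (cases u; cases v; simp add: dot_def cross_def algebra_simps)+

lemma ex_dot_ne_0:
  assumes "l \<noteq> 0"
  shows "\<exists>v. dot l v \<noteq> 0"
proof -
  obtain a b c where l: "l = (a, b, c)" by (cases l)
  have "dot l (1, 0, 0) = a" "dot l (0, 1, 0) = b" "dot l (0, 0, 1) = c" by (simp_all add: l dot_def)
  then show ?thesis using assms l by (metis zero_prod_def)
qed

text \<open>The cross product, if it is nonzero. Otherwise \<open>u\<close> and \<open>v\<close> are
  parallel, and a functional that kills a nonzero one of them kills the other.\<close>

lemma ex_orthogonal: "\<exists>l. l \<noteq> 0 \<and> dot l u = 0 \<and> dot l v = 0"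
proof -
  have perp: "\<exists>l. l \<noteq> 0 \<and> dot l u = 0" for u
  proof (cases u)
    case (fields a b c)
    show ?thesis
    proof (cases "a = 0")
      case True
      then show ?thesis by (intro exI[of _ "(1, 0, 0)"]) (simp add: fields dot_def zero_prod_def)
    next
      case False
      then show ?thesis by (intro exI[of _ "(- b, a, 0)"]) (simp add: fields dot_def zero_prod_def)
    qed
  qed
  show ?thesis
  proof (cases "cross u v = 0")
    case False
    then show ?thesis using dot_cross by blast
  next
    case True
    obtain a b c a' b' c' where uv: "u = (a, b, c)" "v = (a', b', c')" by (metis prod.exhaust)
    have eqs: "b * c' = c * b'" "c * a' = a * c'" "a * b' = b * a'"
      using True by (simp_all add: uv cross_def zero_prod_def)
    show ?thesis
    proof (cases "u = 0")
      case True
      then show ?thesis using perp[of v] by (metis dot_zero)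
    next
      case False
      obtain l where l: "l \<noteq> 0" "dot l u = 0" using perp by blast
      obtain x y z where xyz: "l = (x, y, z)" by (metis prod.exhaust)
      have d: "x * a + y * b + z * c = 0" using l by (simp add: xyz uv dot_def)
      \<comment> \<open>A coordinate of \<open>u\<close> times \<open>dot l v\<close> equals the
        same coordinate of \<open>v\<close> times \<open>dot l u\<close>, because the cross product
        vanishes; some coordinate of \<open>u\<close> is nonzero.\<close>
      have "t * (x * a' + y * b' + z * c') = 0" if "t \<in> {a, b, c}" for t
      proof -
        have "a * (x * a' + y * b' + z * c') = a' * (x * a + y * b + z * c)"
          "b * (x * a' + y * b' + z * c') = b' * (x * a + y * b + z * c)"
          "c * (x * a' + y * b' + z * c') = c' * (x * a + y * b + z * c)"
          using eqs by algebra+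
        then show ?thesis using that d by auto
      qed
      then have "dot l v = 0" using False by (auto simp: uv xyz dot_def zero_prod_def)
      then show ?thesis using l by blast
    qed
  qed
qed

text \<open>Vectors whose first nonzero coordinate is 1: one from each pair \<open>v\<close>,
  \<open>- v\<close>, that is, the 13 points of the projective plane of order 3.\<close>

definition normal :: "vec set" where
  "normal = {(a, b, c). a = 1 \<or> a = 0 \<and> (b = 1 \<or> b = 0 \<and> c = 1)}"

lemma normal_iff: "v \<noteq> 0 \<Longrightarrow> v \<in> normal \<longleftrightarrow> - v \<notin> normal"
proof (cases v)
  case (fields a b c)
  assume "v \<noteq> 0"
  then show ?thesis
    by (cases a; cases b; cases c) (simp_all add: fields normal_def zero_prod_def zero_z3_def one_z3_def)
qed

lemma zero_not_normal: "0 \<notin> normal"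
  by (simp add: normal_def zero_prod_def)

lemma card_normal: "card normal = 13"
proof -
  have U: "card (UNIV - {0 :: vec}) = 26" by (simp add: card_Diff_subset card_z3)
  have "UNIV - {0} = normal \<union> uminus ` normal"
  proof (intro equalityI subsetI)
    fix v :: vec assume "v \<in> UNIV - {0}"
    then have "v \<in> normal \<or> - v \<in> normal" using normal_iff by blast
    then show "v \<in> normal \<union> uminus ` normal" by (metis UnI1 UnI2 imageI minus_minus)
  next
    fix v :: vec assume "v \<in> normal \<union> uminus ` normal"
    then have "v \<noteq> 0" using zero_not_normal by (metis UnE imageE neg_equal_0_iff_equal)
    then show "v \<in> UNIV - {0}" by simp
  qed
  moreover have "normal \<inter> uminus ` normal = {}"
  proof -
    have "- v \<notin> normal" if "v \<in> normal" for v
      using that normal_iff[of v] zero_not_normal by (cases "v = 0") auto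
    then show ?thesis by auto
  qed
  ultimately have "26 = card normal + card (uminus ` normal)"
    using U by (simp add: card_Un_disjoint)
  also have "card (uminus ` normal) = card normal" by (simp add: card_image)
  finally show ?thesis by simp
qed

lemma z3_neg_ne_self: "v \<noteq> 0 \<Longrightarrow> - v \<noteq> (v :: z3)"
  by (cases v) (simp_all add: zero_z3_def)

text \<open>The points are \<open>m\<close> copies of each of the 26 nonzero vectors of the space of dimension 3 over
  the field with 3 elements, the lines are the triples with sum 0, and \<open>v\<close> and \<open>-v\<close> share a group.\<close>
lemma good_vectors:
  assumes ext: "extends (2 * m) w" "0 < m"
  shows "good (26 * m + w)"
proof -
  obtain q where q: "ciq ({0..<int (2 * m)} <+> {..<w}) q"
    and W: "\<And>i j. i < w \<Longrightarrow> j < w \<Longrightarrow> q (Inr i) (Inr j) \<in> Inr ` {..<w}"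
    using ext(1) unfolding extends_def by blast
  define M where "M = int m"
  define D where "D = {0..<2 * M}"
  define A where "A = {0..<M}"
  have M: "0 < M" using ext(2) by (simp add: M_def)
  have modA: "a mod M \<in> A" for a using M by (simp add: A_def)
  \<comment> \<open>In the group of \<open>g\<close>, second components below \<open>M\<close>
    number the copies of \<open>g\<close>, the others those of \<open>- g\<close>;
    \<open>enc\<close> is the inverse coding. The two must share a group because the third vector
    for \<open>v\<close> and \<open>- v\<close> would be 0, which is no point.\<close>
  define vec :: "vec \<times> int \<Rightarrow> vec" where "vec x = (if snd x < M then fst x else - fst x)" for x
  define norm :: "vec \<Rightarrow> vec" where "norm v = (if v \<in> normal then v else - v)" for v
  define enc :: "vec \<Rightarrow> int \<Rightarrow> vec \<times> int" where "enc v a = (norm v, if v \<in> normal then a else a + M)" for v a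
  define h where "h x y = enc (- vec x - vec y) ((snd x + snd y) mod M)" for x y
  have norm_normal: "norm v \<in> normal" if "v \<noteq> 0" for v
    using normal_iff[OF that] by (simp add: norm_def)
  have norm_eq: "u = v \<or> u = - v" if "norm u = norm v" for u v
    using that by (auto simp: norm_def split: if_splits)
  have enc_mem: "enc v a \<in> normal \<times> D" if "v \<noteq> 0" "a \<in> A" for v a
    using norm_normal[OF that(1)] that(2) by (auto simp: enc_def A_def D_def)
  have vec_enc: "vec (enc v a) = v" "snd (enc v a) mod M = a" if "a \<in> A" for v a
    using that by (auto simp: enc_def vec_def norm_def A_def)
  have point: "vec x \<noteq> 0" "norm (vec x) = fst x" "enc (vec x) (snd x mod M) = x"
    if "x \<in> normal \<times> D" for x
  proof -
    have g: "fst x \<in> normal" "fst x \<noteq> 0" "snd x \<in> D" using that zero_not_normal by (auto simp: mem_Times_iff)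
    then have g': "- fst x \<notin> normal" using normal_iff by blast
    show "vec x \<noteq> 0" using g by (simp add: vec_def)
    show n: "norm (vec x) = fst x" using g g' by (simp add: vec_def norm_def)
    have "snd x mod M = (if snd x < M then snd x else snd x - M)"
      using g(3) by (auto simp: D_def mod_pos_pos_trivial intro: mod_pos_pos_trivial)
        (smt (verit, best) minus_mod_self2 mod_pos_pos_trivial)
    then show "enc (vec x) (snd x mod M) = x"
      using g g' n by (auto simp: enc_def vec_def prod_eq_iff)
  qed
  have vec_ne: "vec x \<noteq> vec y" "vec x \<noteq> - vec y"
    if "x \<in> normal \<times> D" "y \<in> normal \<times> D" "fst x \<noteq> fst y" for x y
    using point(2)[OF that(1)] point(2)[OF that(2)] that(3) normal_iff[OF point(1)[OF that(2)]]
    by (auto simp: norm_def)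
  have third: "- vec x - vec y \<noteq> 0" "norm (- vec x - vec y) \<noteq> fst x"
    if "x \<in> normal \<times> D" "y \<in> normal \<times> D" "fst x \<noteq> fst y" for x y
  proof -
    note ne = vec_ne[OF that]
    then show "- vec x - vec y \<noteq> 0" by (metis eq_iff_diff_eq_0 minus_equation_iff)
    show "norm (- vec x - vec y) \<noteq> fst x"
    proof
      assume "norm (- vec x - vec y) = fst x"
      then have "- vec x - vec y = vec x \<or> - vec x - vec y = - vec x"
        using norm_eq point(2)[OF that(1)] by metis
      then show False
      proof
        assume "- vec x - vec y = vec x"
        then have "vec y = - vec x - vec x" by (metis diff_diff_eq2 diff_add_cancel add.commute diff_eq_eq)
        then show False using ne by (simp add: minus_minus_self)
      next
        assume "- vec x - vec y = - vec x"
        then show False using point(1)[OF that(2)] by simp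
      qed
    qed
  qed
  interpret frame normal D "{..<w}" h q
  proof
    show "finite normal" by simp
    show "ciq (D <+> {..<w}) q" using q by (simp add: D_def M_def)
    show "q (Inr i) (Inr j) \<in> Inr ` {..<w}" if "i \<in> {..<w}" "j \<in> {..<w}" for i j
      using W that by simp
  next
    fix x y assume xy: "x \<in> normal \<times> D" "y \<in> normal \<times> D" "fst x \<noteq> fst y"
    show "h x y \<in> normal \<times> D" unfolding h_def by (rule enc_mem[OF third(1)[OF xy] modA])
    show "fst (h x y) \<noteq> fst x" using third(2)[OF xy] by (simp add: h_def enc_def)
    show "h x y = h y x" by (simp only: h_def diff_conv_add_uminus add.commute)
  next
    fix x y z assume xyz: "x \<in> normal \<times> D" "y \<in> normal \<times> D" "z \<in> normal \<times> D" and eq: "h x y = h x z"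
    have "vec y = vec z" using eq vec_enc(1)[OF modA] unfolding h_def by (metis diff_left_imp_eq)
    moreover have "(snd x + snd y) mod M = (snd x + snd z) mod M"
      using eq vec_enc(2)[OF modA] unfolding h_def by metis
    then have "M dvd snd y - snd z" by (metis add_diff_cancel_left mod_eq_dvd_iff)
    then have "snd y mod M = snd z mod M" by (simp add: mod_eq_dvd_iff)
    ultimately show "y = z" using point(3)[OF xyz(2)] point(3)[OF xyz(3)] by metis
  qed
  have ne: "normal \<noteq> {}" "D \<noteq> {}" using card_normal M by (auto simp: D_def)
  have dot_norm: "dot l (norm v) = 0 \<longleftrightarrow> dot l v = 0" for l v
    by (simp add: norm_def dot_minus)
  have "triple_covered X (fill h q)"
  proof (rule triple_covered_fill[OF ne])
    fix x y z assume xyz: "x \<in> normal \<times> D" "y \<in> normal \<times> D" "z \<in> normal \<times> D"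
    have flat: "\<exists>B. B \<subset> normal \<and> fst x \<in> B \<and> fst y \<in> B \<and> fst z \<in> B \<and>
         (\<forall>u \<in> B \<times> D. \<forall>v \<in> B \<times> D. fst u \<noteq> fst v \<longrightarrow> fst (h u v) \<in> B)"
      if l: "l \<noteq> 0" "dot l (vec x) = 0" "dot l (vec y) = 0" "dot l (vec z) = 0" for l
    \<comment> \<open>Planes through the origin are the closed sets.\<close>
    proof (intro exI[of _ "{g \<in> normal. dot l g = 0}"] conjI ballI impI)
      obtain v where "dot l v \<noteq> 0" using ex_dot_ne_0[OF l(1)] by blast
      then have "norm v \<in> normal" "dot l (norm v) \<noteq> 0" using norm_normal dot_zero dot_norm by metis+
      then show "{g \<in> normal. dot l g = 0} \<subset> normal" by blast
      have "fst t \<in> {g \<in> normal. dot l g = 0}" if "t \<in> normal \<times> D" "dot l (vec t) = 0" for t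
        using that point(2)[OF that(1)] dot_norm[of l "vec t"] by auto
      then show "fst x \<in> {g \<in> normal. dot l g = 0}" "fst y \<in> {g \<in> normal. dot l g = 0}"
        "fst z \<in> {g \<in> normal. dot l g = 0}" using xyz l by blast+
      fix u v assume uv: "u \<in> {g \<in> normal. dot l g = 0} \<times> D" "v \<in> {g \<in> normal. dot l g = 0} \<times> D"
        and "fst u \<noteq> fst v"
      then have uv': "u \<in> normal \<times> D" "v \<in> normal \<times> D" by auto
      have "dot l (vec u) = 0" "dot l (vec v) = 0"
        using uv point(2)[OF uv'(1)] point(2)[OF uv'(2)] dot_norm[of l "vec u"] dot_norm[of l "vec v"] by auto
      then have "dot l (- vec u - vec v) = 0" by (simp add: dot_diff dot_minus)
      then have "dot l (fst (h u v)) = 0" using dot_norm by (simp add: h_def enc_def)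
      moreover have "fst (h u v) \<in> normal"
        using h_closed[OF uv' \<open>fst u \<noteq> fst v\<close>] by auto
      ultimately show "fst (h u v) \<in> {g \<in> normal. dot l g = 0}" by simp
    qed
    show "(\<exists>B. B \<subset> normal \<and> fst x \<in> B \<and> fst y \<in> B \<and> fst z \<in> B \<and>
         (\<forall>u \<in> B \<times> D. \<forall>v \<in> B \<times> D. fst u \<noteq> fst v \<longrightarrow> fst (h u v) \<in> B)) \<or>
      (\<exists>R C S. R \<subseteq> normal \<times> D \<and> C \<subseteq> normal \<times> D \<and> fst ` R \<inter> fst ` C = {} \<and> card R = card C \<and>
         card S = card R \<and> (\<forall>u\<in>R. \<forall>v\<in>C. h u v \<in> S) \<and> x \<in> R \<and> y \<in> C \<and> z \<in> S)"
    proof (cases "fst x = fst y")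
      case True
      then have pm: "vec x = vec y \<or> vec x = - vec y" using point(2) xyz norm_eq by metis
      obtain l where l: "l \<noteq> 0" "dot l (vec x) = 0" "dot l (vec z) = 0" using ex_orthogonal by blast
      then have "dot l (vec y) = 0" using pm by (auto simp: dot_minus)
      then show ?thesis using l by (intro disjI1 flat[of l])
    next
      case False
      note ne = vec_ne[OF xyz(1,2) False]
      obtain l where l: "l \<noteq> 0" "dot l (vec x) = 0" "dot l (vec y) = 0" using ex_orthogonal by blast
      show ?thesis
      proof (cases "dot l (vec z) = 0")
        case True
        then show ?thesis using l by (intro disjI1 flat[of l])
      next
        case nz: False
        \<comment> \<open>As in the affine plane, \<open>- vec x - vec y\<close> differs from
          \<open>vec z\<close> by \<open>d\<close>. Since \<open>l\<close> vanishes on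
          \<open>vec x\<close> and \<open>vec y\<close> but not on \<open>d\<close>, it separates
          the members of their cosets; this keeps 0 out of both cosets and their groups
          apart.\<close>
        define d where "d = vec x + vec y + vec z"
        have d: "dot l d = dot l (vec z)" using l by (simp add: d_def dot_add)
        then have "d \<noteq> 0" using nz dot_zero by metis
        have sgn: "u = v" if "u \<in> {0, d, - d}" "v \<in> {0, d, - d}" "dot l u = dot l v" for u v
          using that d nz z3_neg_ne_self[OF nz] by (auto simp: dot_minus dot_zero)
        have nonzero: "v \<noteq> 0" if v: "v \<in> coset (vec t) d" and t: "t \<in> normal \<times> D" "dot l (vec t) = 0" for v t
        proof
          assume "v = 0"
          obtain u where u: "u \<in> {0, d, - d}" "v = vec t + u" using v by (rule cosetE)
          then have "dot l u = dot l 0" using t(2) \<open>v = 0\<close> dot_add[of l "vec t" u] by (simp add: dot_zero)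
          then have "u = 0" using u(1) by (intro sgn) auto
          then show False using u(2) \<open>v = 0\<close> point(1)[OF t(1)] by simp
        qed
        define K where "K v = (\<lambda>(v, a). enc v a) ` (coset v d \<times> A)" for v
        have mem: "t \<in> K (vec t)" if "t \<in> normal \<times> D" for t
          unfolding K_def using point(3)[OF that] modA[of "snd t"] self_in_coset[of "vec t" d]
          by (intro image_eqI[of _ _ "(vec t, snd t mod M)"]) simp_all
        have cardK: "card (K v) = 3 * m" for v
        proof -
          have "a = b \<and> i = j" if "i \<in> A" "j \<in> A" "enc a i = enc b j" for a b i j
            using vec_enc[OF that(1), of a] vec_enc[OF that(2), of b] that(3) by simp
          then have "inj_on (\<lambda>(v, a). enc v a) (coset v d \<times> A)" by (auto intro!: inj_onI)
          then have "card (K v) = card (coset v d \<times> A)" unfolding K_def by (rule card_image)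
          then show ?thesis using card_coset[OF \<open>d \<noteq> 0\<close>] by (simp add: card_cartesian_product A_def M_def)
        qed
        have KD: "K (vec t) \<subseteq> normal \<times> D" if t: "t \<in> normal \<times> D" "dot l (vec t) = 0" for t
          unfolding K_def
        proof (rule image_subsetI)
          fix p assume "p \<in> coset (vec t) d \<times> A"
          then show "(case p of (v, a) \<Rightarrow> enc v a) \<in> normal \<times> D"
            using enc_mem[OF nonzero[OF _ t], of "fst p" "snd p"] by (auto simp: mem_Times_iff case_prod_beta)
        qed
        have KE: "\<exists>a i. p = enc a i \<and> a \<in> coset v d \<and> i \<in> A" if "p \<in> K v" for p v
        proof -
          obtain e where "e \<in> coset v d \<times> A" "p = enc (fst e) (snd e)"
            using \<open>p \<in> K v\<close> unfolding K_def by (elim imageE) (simp add: case_prod_beta)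
          then show ?thesis by (intro exI[of _ "fst e"] exI[of _ "snd e"]) (simp add: mem_Times_iff)
        qed
        have "fst ` K (vec x) \<inter> fst ` K (vec y) = {}"
        proof (rule ccontr)
          assume "fst ` K (vec x) \<inter> fst ` K (vec y) \<noteq> {}"
          then obtain p p' where p: "p \<in> K (vec x)" "p' \<in> K (vec y)" "fst p = fst p'" by blast
          obtain a b where ab: "a \<in> coset (vec x) d" "b \<in> coset (vec y) d" "norm a = norm b"
            using KE[OF p(1)] KE[OF p(2)] p(3) by (metis enc_def fst_conv)
          obtain u where u: "u \<in> {0, d, - d}" "a = vec x + u" using ab(1) by (rule cosetE)
          obtain v where v: "v \<in> {0, d, - d}" "b = vec y + v" using ab(2) by (rule cosetE)
          have dots: "dot l a = dot l u" "dot l b = dot l v" using u v l by (simp_all add: dot_add)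
          from norm_eq[OF ab(3)] show False
          proof
            assume "a = b"
            then have "dot l u = dot l v" using dots by simp
            then have "u = v" using u(1) v(1) sgn by blast
            then show False using \<open>a = b\<close> u v ne(1) by simp
          next
            assume "a = - b"
            then have "dot l u = dot l (- v)" using dots dot_minus by metis
            moreover have "- v \<in> {0, d, - d}" using v(1) by auto
            ultimately have "u = - v" using u(1) sgn by blast
            then show False using \<open>a = - b\<close> u v ne(2) by simp
          qed
        qed
        moreover have "\<forall>u\<in>K (vec x). \<forall>v\<in>K (vec y). h u v \<in> K (vec z)"
        proof (intro ballI)
          fix u v assume "u \<in> K (vec x)" "v \<in> K (vec y)"
          obtain a i b j where ab: "u = enc a i" "a \<in> coset (vec x) d" "i \<in> A"
            "v = enc b j" "b \<in> coset (vec y) d" "j \<in> A"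
            using KE[OF \<open>u \<in> K (vec x)\<close>] KE[OF \<open>v \<in> K (vec y)\<close>] by metis
          have "- vec x - vec y \<in> coset (vec z) d" by (simp add: coset_def d_def)
          then have "- a - b \<in> coset (vec z) d"
            using coset_closed[OF ab(2,5)] coset_eq by metis
          moreover have "h u v = enc (- a - b) ((snd u + snd v) mod M)"
            using ab vec_enc(1) by (simp add: h_def)
          ultimately show "h u v \<in> K (vec z)" unfolding K_def using modA
            by (intro image_eqI[of _ _ "(- a - b, (snd u + snd v) mod M)"]) simp_all
        qed
        ultimately show ?thesis
          using mem[OF xyz(1)] mem[OF xyz(2)] mem[OF xyz(3)] cardK KD[OF xyz(1) l(2)] KD[OF xyz(2) l(3)]
          by (intro disjI2 exI[of _ "K (vec x)"] exI[of _ "K (vec y)"] exI[of _ "K (vec z)"]) simp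
      qed
    qed
  qed
  moreover have "card X = 26 * m + w" using card_X by (simp add: D_def M_def card_normal)
  ultimately show ?thesis using goodI ciq_fill[OF ne(1)] by blast
qed

section \<open>Orders 65, 67 and 69\<close>

text \<open>Three copies of \<open>D\<close>, glued along \<open>W\<close>.  The maps \<open>\<kappa> p\<close> are congruences of the totally
  symmetric operation \<open>g\<close>, so classes chosen in two of the copies determine one in the third;
  together with \<open>F p\<close> they form a subsquare.\<close>
lemma good_three:
  fixes D :: "'d set" and W :: "'w set" and \<kappa> :: "'p \<Rightarrow> 'd \<Rightarrow> 'k" and F :: "'p \<Rightarrow> 'w set"
  assumes q: "ciq (D <+> W) q" and W: "\<And>i j. \<lbrakk>i \<in> W; j \<in> W\<rbrakk> \<Longrightarrow> q (Inr i) (Inr j) \<in> Inr ` W"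
    and D: "D \<noteq> {}"
    and g: "\<And>x y. \<lbrakk>x \<in> D; y \<in> D\<rbrakk> \<Longrightarrow> g x y \<in> D \<and> g x y = g y x \<and> g x (g x y) = y"
    and \<kappa>: "\<And>p x x' y y'. \<lbrakk>x \<in> D; x' \<in> D; y \<in> D; y' \<in> D; \<kappa> p x = \<kappa> p x'; \<kappa> p y = \<kappa> p y'\<rbrakk> \<Longrightarrow>
        \<kappa> p (g x y) = \<kappa> p (g x' y')"
    and block: "\<And>p k u v. \<lbrakk>u \<in> {x \<in> D. \<kappa> p x = k} <+> F p; v \<in> {x \<in> D. \<kappa> p x = k} <+> F p\<rbrakk> \<Longrightarrow>
        q u v \<in> {x \<in> D. \<kappa> p x = k} <+> F p"
    and F: "\<And>p. F p \<subseteq> W" "\<And>i. i \<in> W \<Longrightarrow> \<exists>p. i \<in> F p"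
    and pair: "\<And>x y. \<lbrakk>x \<in> D; y \<in> D\<rbrakk> \<Longrightarrow> \<exists>p. \<kappa> p x = \<kappa> p y"
    and proper: "\<And>p k. \<exists>x\<in>D. \<kappa> p x \<noteq> k"
  shows "good (3 * card D + card W)"
proof -
  define h :: "z3 \<times> 'd \<Rightarrow> z3 \<times> 'd \<Rightarrow> z3 \<times> 'd" where
    "h x y = (- fst x - fst y, g (snd x) (snd y))" for x y
  interpret frame UNIV D W h q
  proof
    fix x y :: "z3 \<times> 'd" assume xy: "x \<in> UNIV \<times> D" "y \<in> UNIV \<times> D" "fst x \<noteq> fst y"
    show "h x y \<in> UNIV \<times> D" using xy g by (simp add: h_def mem_Times_iff)
    show "fst (h x y) \<noteq> fst x" using z3_third[OF xy(3)] by (simp add: h_def)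
    show "h x y = h y x"
      using xy g[of "snd x" "snd y"] by (simp add: h_def mem_Times_iff)
  next
    fix x y z :: "z3 \<times> 'd" assume xyz: "x \<in> UNIV \<times> D" "y \<in> UNIV \<times> D" "z \<in> UNIV \<times> D" "h x y = h x z"
    then have "fst y = fst z" "g (snd x) (snd y) = g (snd x) (snd z)" by (simp_all add: h_def)
    moreover from this have "snd y = snd z" using g xyz(1-3) by (metis mem_Times_iff)
    ultimately show "y = z" by (simp add: prod_eq_iff)
  qed (use q W in auto)
  have q': "ciq X (fill h q)" by (rule ciq_fill) simp
  have in_part: "\<exists>B. B \<subset> X \<and> (\<forall>x\<in>B. \<forall>y\<in>B. fill h q x y \<in> B) \<and> r \<in> B \<and> c \<in> B \<and> s \<in> B"
    if "{r, c, s} \<subseteq> ({i} \<times> D) <+> W" for r c s i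
  proof (intro exI[of _ "({i} \<times> D) <+> W"] conjI)
    obtain a where "a \<in> D" using D by blast
    then have "Inl (i + 1, a) \<in> X - ({i} \<times> D <+> W)" by auto
    moreover have "{i} \<times> D <+> W \<subseteq> X" by auto
    ultimately show "{i} \<times> D <+> W \<subset> X" by blast
    show "\<forall>x\<in>{i} \<times> D <+> W. \<forall>y\<in>{i} \<times> D <+> W. fill h q x y \<in> {i} \<times> D <+> W"
      by (intro ballI fill_closed_groups) auto
  qed (use that in auto)
  have in_two: "\<exists>B. B \<subset> X \<and> (\<forall>x\<in>B. \<forall>y\<in>B. fill h q x y \<in> B) \<and> Inl (i, a) \<in> B \<and> Inl (j, b) \<in> B \<and> t \<in> B"
    if ij: "i \<noteq> j" and ab: "a \<in> D" "b \<in> D" and t: "t \<in> ({i, j} \<times> D) <+> W" for i j a b t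
  proof -
    \<comment> \<open>If \<open>t\<close> is in copy \<open>i\<close> or \<open>j\<close>,
      \<open>p\<close> puts it into the class of \<open>a\<close> or \<open>b\<close>; if
      \<open>t\<close> is in \<open>W\<close>, it is taken from \<open>F p\<close>. The closed set
      then consists of one class in each of the three copies, together with
      \<open>F p\<close>.\<close>
    obtain p where p: "t \<in> ({i} \<times> {x. \<kappa> p x = \<kappa> p a} \<union> {j} \<times> {x. \<kappa> p x = \<kappa> p b}) <+> F p"
    proof (cases t)
      case (Inl e)
      then have e: "snd e \<in> D" "fst e = i \<or> fst e = j" using t by auto
      show ?thesis
      proof (cases "fst e = i")
        case True
        obtain p where "\<kappa> p (snd e) = \<kappa> p a" using pair e ab by blast
        then show ?thesis using that[of p] True Inl by (cases e) auto
      next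
        case False
        then have "fst e = j" using e by simp
        obtain p where "\<kappa> p (snd e) = \<kappa> p b" using pair e ab by blast
        then show ?thesis using that[of p] \<open>fst e = j\<close> Inl by (cases e) auto
      qed
    next
      case (Inr w)
      then obtain p where "w \<in> F p" using t F(2) by auto
      then show ?thesis using that[of p] Inr by auto
    qed
    define \<alpha> where "\<alpha> k = (if k = i then \<kappa> p a else if k = j then \<kappa> p b else \<kappa> p (g a b))" for k
    define B where "B = {e. snd e \<in> D \<and> \<kappa> p (snd e) = \<alpha> (fst e)} <+> F p"
    have \<alpha>: "\<kappa> p (g x y) = \<alpha> (- k - l)"
      if x: "x \<in> D" "\<kappa> p x = \<alpha> k" and y: "y \<in> D" "\<kappa> p y = \<alpha> l" and "k \<noteq> l" for x y k l
    proof -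
      \<comment> \<open>\<open>a\<close>, \<open>b\<close> and \<open>g a b\<close>, placed in the
        three copies, are representatives of the classes. As \<open>g\<close> is totally symmetric,
        any two of them multiply to the third; the congruence carries this over to the whole
        classes.\<close>
      obtain r where r: "\<And>k. r k \<in> D \<and> \<kappa> p (r k) = \<alpha> k" "r (- k - l) = g (r k) (r l)"
      proof -
        define r where "r k = (if k = i then a else if k = j then b else g a b)" for k
        have "r k \<in> D \<and> \<kappa> p (r k) = \<alpha> k" for k using ab g by (simp add: r_def \<alpha>_def)
        moreover have "r (- k - l) = g (r k) (r l)"
        proof -
          have gab: "g a b = g b a" "g a (g a b) = b" "g b (g a b) = a" "g (g a b) a = b" "g (g a b) b = a"
            using ab g by metis+
          define m where "m = - i - j"
          have m: "m \<noteq> i" "m \<noteq> j" using z3_third[OF ij] z3_third[OF ij[symmetric]] by (simp_all add: m_def)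
          have "k = i \<or> k = j \<or> k = m" "l = i \<or> l = j \<or> l = m"
            using z3_third_unique[OF ij] by (auto simp: m_def)
          moreover have "- k - l = (if k \<noteq> i \<and> l \<noteq> i then i else if k \<noteq> j \<and> l \<noteq> j then j else m)"
            using z3_third_unique[OF \<open>k \<noteq> l\<close>, of i] z3_third_unique[OF \<open>k \<noteq> l\<close>, of j]
              z3_third_unique[OF \<open>k \<noteq> l\<close>, of m] m ij by auto
          ultimately show ?thesis using \<open>k \<noteq> l\<close> m ij gab by (auto simp: r_def)
        qed
        ultimately show ?thesis using that by blast
      qed
      have "\<kappa> p (g x y) = \<kappa> p (g (r k) (r l))" using x y r(1) by (intro \<kappa>) auto
      then show ?thesis using r by metis
    qed
    have "B \<subset> X"
    proof
      show "B \<subseteq> X" using F(1) by (auto simp: B_def)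
      obtain x where "x \<in> D" "\<kappa> p x \<noteq> \<alpha> i" using proper by blast
      then have "Inl (i, x) \<in> X" "Inl (i, x) \<notin> B" by (auto simp: B_def)
      then show "B \<noteq> X" by blast
    qed
    moreover have "\<forall>u\<in>B. \<forall>v\<in>B. fill h q u v \<in> B"
    proof (intro ballI)
      fix u v assume uv: "u \<in> B" "v \<in> B"
      then have "u \<in> X" "v \<in> X" using \<open>B \<subset> X\<close> by blast+
      from same_group_or_cross[OF this UNIV_not_empty] show "fill h q u v \<in> B"
      proof cases
        case (1 k)
        obtain u' v' where uv': "u' \<in> D <+> W" "v' \<in> D <+> W" "u = map_sum (Pair k) id u'"
            "v = map_sum (Pair k) id v'" "fill h q u v = map_sum (Pair k) id (q u' v')"
          by (rule fill_same_group[OF 1(2,3)])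
        have "u' \<in> {x \<in> D. \<kappa> p x = \<alpha> k} <+> F p" "v' \<in> {x \<in> D. \<kappa> p x = \<alpha> k} <+> F p"
          using uv uv' by (cases u'; cases v'; auto simp: B_def)+
        then have "q u' v' \<in> {x \<in> D. \<kappa> p x = \<alpha> k} <+> F p" by (rule block)
        then show ?thesis using uv'(5) by (auto simp: B_def)
      next
        case (2 x y)
        then have "snd x \<in> D" "\<kappa> p (snd x) = \<alpha> (fst x)" "snd y \<in> D" "\<kappa> p (snd y) = \<alpha> (fst y)"
          using uv by (auto simp: B_def)
        then have "g (snd x) (snd y) \<in> D" "\<kappa> p (g (snd x) (snd y)) = \<alpha> (- fst x - fst y)"
          using \<alpha> g 2(5) by blast+
        then show ?thesis using 2 by (simp add: fill_cross B_def h_def InlI)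
      qed
    qed
    moreover have "Inl (i, a) \<in> B" "Inl (j, b) \<in> B" using ab ij by (auto simp: B_def \<alpha>_def)
    moreover have "t \<in> B" using p t ij by (auto simp: B_def \<alpha>_def)
    ultimately show ?thesis by blast
  qed
  have "triple_covered X (fill h q)"
    unfolding triple_covered_def
  proof (intro ballI)
    fix r c s assume rcs: "r \<in> X" "c \<in> X" "s \<in> X"
    let ?flat = "\<exists>B. B \<subset> X \<and> (\<forall>x\<in>B. \<forall>y\<in>B. fill h q x y \<in> B) \<and> r \<in> B \<and> c \<in> B \<and> s \<in> B"
    let ?rect = "\<exists>R C S. R \<subseteq> X \<and> C \<subseteq> X \<and> R \<inter> C = {} \<and> card R = card C \<and> card S = card R \<and>
        (\<forall>x\<in>R. \<forall>y\<in>C. fill h q x y \<in> S) \<and> r \<in> R \<and> c \<in> C \<and> s \<in> S"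
    \<comment> \<open>For three points in three different copies the whole copies form the
      rectangle.\<close>
    have rect: ?rect if "r = Inl (i, a)" "c = Inl (j, b)" "s = Inl (- i - j, e)" "i \<noteq> j" for i j a b e
    proof (intro exI conjI)
      show "Inl ` ({i} \<times> D) \<subseteq> X" "Inl ` ({j} \<times> D) \<subseteq> X" by auto
      show "Inl ` ({i} \<times> D) \<inter> Inl ` ({j} \<times> D) = {}" using that(4) by auto
      show "card (Inl ` ({i} \<times> D) :: ((z3 \<times> 'd) + 'w) set) = card (Inl ` ({j} \<times> D) :: ((z3 \<times> 'd) + 'w) set)"
        "card (Inl ` ({- i - j} \<times> D) :: ((z3 \<times> 'd) + 'w) set) = card (Inl ` ({i} \<times> D) :: ((z3 \<times> 'd) + 'w) set)"
        by (simp_all add: card_image card_cartesian_product)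
      show "\<forall>x\<in>Inl ` ({i} \<times> D). \<forall>y\<in>Inl ` ({j} \<times> D). fill h q x y \<in> Inl ` ({- i - j} \<times> D)"
        using g that(4) by (auto simp: fill_cross h_def)
      show "r \<in> Inl ` ({i} \<times> D)" "c \<in> Inl ` ({j} \<times> D)" "s \<in> Inl ` ({- i - j} \<times> D)"
        using that rcs by auto
    qed
    have flat2: ?flat if "u \<in> {r, c, s}" "u = Inl (i, a)" "v \<in> {r, c, s}" "v = Inl (j, b)" "i \<noteq> j"
      "{r, c, s} \<subseteq> {u, v, t}" "t \<in> ({i, j} \<times> D) <+> W" for u v t i j a b
    proof -
      have "a \<in> D" "b \<in> D" using that(1-4) rcs by auto
      then show ?thesis using in_two[OF that(5) _ _ that(7), of a b] that(2,4,6)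
        by (metis insert_subset insert_iff singletonD)
    qed
    show "?flat \<or> ?rect"
    proof (cases "\<exists>i. {r, c, s} \<subseteq> ({i} \<times> D) <+> W")
      case True
      then obtain i where "{r, c, s} \<subseteq> ({i} \<times> D) <+> W" ..
      then show ?thesis by (intro disjI1 in_part)
    next
      case False
      have other: "\<exists>u\<in>{r, c, s}. \<exists>j b. u = Inl (j, b) \<and> j \<noteq> i \<and> b \<in> D" for i
      proof (rule ccontr)
        assume "\<not> ?thesis"
        then have "{r, c, s} \<subseteq> ({i} \<times> D) <+> W" using rcs by (auto elim!: PlusE)
        then show False using False by blast
      qed
      obtain u i a where u: "u \<in> {r, c, s}" "u = Inl (i, a)" using other by metis
      obtain v j b where v: "v \<in> {r, c, s}" "v = Inl (j, b)" "i \<noteq> j" using other by metis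
      have "u \<noteq> v" using u v by auto
      then obtain t where t: "t \<in> {r, c, s}" "{r, c, s} = {u, v, t}" using u(1) v(1) by auto
      show ?thesis
      proof (cases "t \<in> ({i, j} \<times> D) <+> W")
        case True
        have "{r, c, s} \<subseteq> {u, v, t}" using t(2) by simp
        then show ?thesis using u v True by (intro disjI1 flat2)
      next
        case False
        then obtain k e where k: "t = Inl (k, e)" "k \<noteq> i" "k \<noteq> j" using t(1) rcs by auto
        then have "u \<noteq> t" "v \<noteq> t" using u v by auto
        obtain i' a' j' b' k' e' where "r = Inl (i', a')" "c = Inl (j', b')" "s = Inl (k', e')"
            "i' \<noteq> j'" "k' = - i' - j'"
        proof -
          have "card {r, c, s} = 3" unfolding t(2) using \<open>u \<noteq> v\<close> \<open>u \<noteq> t\<close> \<open>v \<noteq> t\<close> by simp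
          then have ne: "r \<noteq> c" "r \<noteq> s" "c \<noteq> s" by (auto simp: card_insert_if split: if_splits)
          have "inj_on (\<lambda>e. fst (projl e)) {r, c, s}" "\<forall>e\<in>{r, c, s}. isl e"
            unfolding t(2) using u v k by auto
          then have fst_ne: "fst (projl r) \<noteq> fst (projl c)" "fst (projl s) \<noteq> fst (projl r)"
              "fst (projl s) \<noteq> fst (projl c)" and "isl r" "isl c" "isl s"
            using ne by (auto dest: inj_onD)
          then have "r = Inl (fst (projl r), snd (projl r))" "c = Inl (fst (projl c), snd (projl c))"
              "s = Inl (fst (projl s), snd (projl s))" by simp_all
          then show ?thesis using fst_ne(1) z3_third_unique[OF fst_ne] by (rule that)
        qed
        then show ?thesis by (intro disjI2 rect) simp_all
      qed
    qed
  qed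
  moreover have "card X = 3 * card D + card W" using card_X by (simp add: card_z3)
  ultimately show ?thesis using goodI[OF q'] by blast
qed

section \<open>The doubled affine plane of order 3 in executable form\<close>

type_synonym point = "z3 \<times> z3 \<times> bool"

definition points :: "point list" where
  "points = List.product [Z0, Z1, Z2] (List.product [Z0, Z1, Z2] [False, True])"

text \<open>\<open>None\<close> is the direction of the lines with constant first coordinate, \<open>Some s\<close> that of the
  lines of slope \<open>s\<close>; \<open>line p\<close> separates the parallel lines of direction \<open>p\<close>.\<close>
definition direction :: "point \<Rightarrow> point \<Rightarrow> z3 option" where
  "direction x y = (case (x, y) of ((a, b, _), (a', b', _)) \<Rightarrow>
     if a = a' then None else Some ((b' + - b) * (a' + - a)))"

definition line :: "z3 option \<Rightarrow> point \<Rightarrow> z3" where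
  "line p x = (case x of (a, b, _) \<Rightarrow> (case p of None \<Rightarrow> a | Some s \<Rightarrow> b + - (s * a)))"

definition param :: "z3 option \<Rightarrow> point \<Rightarrow> z3" where
  "param p x = (case x of (a, b, _) \<Rightarrow> (case p of None \<Rightarrow> b | Some _ \<Rightarrow> a))"

text \<open>A factorization of the octahedron with vertices \<open>z3 \<times> bool\<close> into four perfect matchings:
  \<open>factor t i j\<close> is the matching that contains the edge from \<open>(t, i)\<close> to \<open>(t + 1, j)\<close>.\<close>
fun factor :: "z3 \<Rightarrow> bool \<Rightarrow> bool \<Rightarrow> nat" where
  "factor Z0 i j = (if i then if j then 3 else 2 else if j then 1 else 0)"
| "factor Z1 i j = (if i then if j then 0 else 2 else if j then 3 else 1)"
| "factor Z2 i j = (if i then if j then 1 else 2 else if j then 0 else 3)"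

text \<open>Elements of \<open>W\<close> are \<open>0\<close>, lying on every line, and the points \<open>U p\<close> on the lines of
  direction \<open>p\<close>.  A line, doubled and extended in this way, carries the Fano plane, the affine
  plane of order 3, or the octahedron factorization, as \<open>U p\<close> has 0, 2 or 4 elements.\<close>
definition mult :: "(z3 option \<Rightarrow> nat list) \<Rightarrow> point \<Rightarrow> point \<Rightarrow> point + nat" where
  "mult U x y = (case (x, y) of ((a, b, i), (a', b', j)) \<Rightarrow>
     if a = a' \<and> b = b' then (if i = j then Inl x else Inr 0)
     else let p = direction x y; t = param p x; t' = param p y; n = length (U p) in
       if n = 0 then Inl (- a + - a', - b + - b', i \<noteq> j)
       else if n = 2 then
         (if i = j then Inl (- a + - a', - b + - b', i)
          else Inr (U p ! (if (t' = t + Z1) = i then 1 else 0)))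
       else Inr (U p ! (if t' = t + Z1 then factor t i j else factor t' j i)))"

text \<open>A point times \<open>w\<close> is the point \<open>y\<close> for which \<open>x\<close>
  times \<open>y\<close> is \<open>w\<close>, as in a totally symmetric system; it is found by
  search so that it can be evaluated.\<close>

definition mult_inv :: "(z3 option \<Rightarrow> nat list) \<Rightarrow> point \<Rightarrow> nat \<Rightarrow> point" where
  "mult_inv U x w = the (List.find (\<lambda>y. mult U x y = Inr w) points)"

fun glue :: "(z3 option \<Rightarrow> nat list) \<Rightarrow> nat list list \<Rightarrow> point + nat \<Rightarrow> point + nat \<Rightarrow> point + nat" where
  "glue U tab (Inl x) (Inl y) = mult U x y"
| "glue U tab (Inl x) (Inr j) = Inl (mult_inv U x j)"
| "glue U tab (Inr i) (Inl y) = Inl (mult_inv U y i)"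
| "glue U tab (Inr i) (Inr j) = Inr (tab ! i ! j)"

text \<open>Those hypotheses of \<open>good_three\<close> that depend on \<open>U\<close> and
  \<open>tab\<close>, in a form that evaluates, for \<open>line\<close> as the congruences and
  \<open>set (0 # U p)\<close> as \<open>F p\<close>: rows of points, rows of \<open>W\<close>,
  closure of lines, covering of \<open>W\<close>.\<close>

definition glue_ok :: "(z3 option \<Rightarrow> nat list) \<Rightarrow> nat list list \<Rightarrow> nat \<Rightarrow> bool" where
  "glue_ok U tab f \<longleftrightarrow>
     (\<forall>x\<in>set points. distinct (map (mult U x) points @ map (\<lambda>i. Inl (mult_inv U x i)) [0..<f]) \<and>
        (\<forall>y\<in>set points. mult U x y = mult U y x \<and> (case mult U x y of Inl _ \<Rightarrow> True | Inr i \<Rightarrow> i < f))) \<and>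
     (\<forall>i\<in>set [0..<f]. tab ! i ! i = i \<and> distinct (map (\<lambda>x. mult_inv U x i) points) \<and>
        distinct (map (\<lambda>j. tab ! i ! j) [0..<f]) \<and>
        (\<forall>j\<in>set [0..<f]. tab ! i ! j = tab ! j ! i \<and> tab ! i ! j < f)) \<and>
     (\<forall>p\<in>set [None, Some Z0, Some Z1, Some Z2].
        (\<forall>i\<in>set (0 # U p). i < f \<and> (\<forall>j\<in>set (0 # U p). tab ! i ! j \<in> set (0 # U p)) \<and>
           (\<forall>x\<in>set points. line p (mult_inv U x i) = line p x)) \<and>
        (\<forall>x\<in>set points. \<forall>y\<in>set points. line p x = line p y \<longrightarrow>
           (case mult U x y of Inl z \<Rightarrow> line p z = line p x | Inr i \<Rightarrow> i \<in> set (0 # U p)))) \<and>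
     (\<forall>i\<in>set [0..<f]. \<exists>p\<in>set [None, Some Z0, Some Z1, Some Z2]. i \<in> set (0 # U p))"

lemma set_points: "set points = UNIV"
  unfolding points_def set_product using UNIV_z3 by (auto simp: UNIV_bool)

lemma good_glue:
  assumes ok: "glue_ok U tab f"
  shows "good (54 + f)"
proof -
  \<comment> \<open>Third point in the plane, with the Booleans added modulo 2.
    \<open>line p\<close> is linear and forgets the Boolean, hence respects
    \<open>g\<close>.\<close>
  define g :: "point \<Rightarrow> point \<Rightarrow> point" where
    "g x y = (case (x, y) of ((a, b, i), (a', b', j)) \<Rightarrow> (- a - a', - b - b', i \<noteq> j))" for x y
  have pts: "x \<in> set points" for x by (simp add: set_points)
  have dirs: "p \<in> set [None, Some Z0, Some Z1, Some Z2]" for p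
  proof (cases p)
    case (Some s)
    then show ?thesis by (cases s) simp_all
  qed simp
  have m_distinct: "distinct (map (mult U x) points @ map (\<lambda>i. Inl (mult_inv U x i)) [0..<f])" for x
    using ok pts unfolding glue_ok_def by blast
  have m_comm: "mult U x y = mult U y x" and m_less: "mult U x y = Inr i \<Longrightarrow> i < f" for x y i
    using ok pts unfolding glue_ok_def by (blast, metis sum.simps(6))
  have tab: "tab ! i ! i = i" "distinct (map (\<lambda>x. mult_inv U x i) points)"
      "distinct (map (\<lambda>j. tab ! i ! j) [0..<f])" if "i < f" for i
    using ok that unfolding glue_ok_def by (metis atLeastLessThan_iff le0 set_upt)+
  have tab_comm: "tab ! i ! j = tab ! j ! i" "tab ! i ! j < f" if "i < f" "j < f" for i j
    using ok that unfolding glue_ok_def by (metis atLeastLessThan_iff le0 set_upt)+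
  have F: "i < f" "j \<in> set (0 # U p) \<Longrightarrow> tab ! i ! j \<in> set (0 # U p)" "line p (mult_inv U x i) = line p x"
    if "i \<in> set (0 # U p)" for p i j x
    using ok that dirs[of p] pts unfolding glue_ok_def by blast+
  have on_line: "case mult U x y of Inl z \<Rightarrow> line p z = line p x | Inr i \<Rightarrow> i \<in> set (0 # U p)"
    if "line p x = line p y" for p x y
    using ok that dirs[of p] pts unfolding glue_ok_def by blast
  have F_cover: "\<exists>p. i \<in> set (0 # U p)" if "i < f" for i
    using ok that unfolding glue_ok_def by (metis atLeastLessThan_iff le0 set_upt)
  have q: "ciq (UNIV <+> {..<f}) (glue U tab)"
  proof (rule ciqI)
    fix v :: "point + nat" assume "v \<in> UNIV <+> {..<f}"
    then show "glue U tab v v = v"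
      using tab(1) by (cases v) (auto simp: mult_def)
  next
    fix v w :: "point + nat" assume vw: "v \<in> UNIV <+> {..<f}" "w \<in> UNIV <+> {..<f}"
    have "i < f" if "glue U tab v w = Inr i" for i
      using that vw m_less[of _ _ i] tab_comm(2) by (cases v; cases w) auto
    then show "glue U tab v w \<in> UNIV <+> {..<f}" by (cases "glue U tab v w") auto
    show "glue U tab v w = glue U tab w v"
      using vw m_comm tab_comm(1) by (cases v; cases w) auto
  next
    fix v w w' :: "point + nat" assume vw: "v \<in> UNIV <+> {..<f}" "w \<in> UNIV <+> {..<f}" "w' \<in> UNIV <+> {..<f}"
      and eq: "glue U tab v w = glue U tab v w'"
    show "w = w'"
    proof (cases v)
      case (Inl x)
      have "map (glue U tab (Inl x)) (map Inl points @ map Inr [0..<f]) =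
          map (mult U x) points @ map (\<lambda>i. Inl (mult_inv U x i)) [0..<f]" by (simp add: comp_def)
      then have "inj_on (glue U tab (Inl x)) (set (map Inl points @ map Inr [0..<f]))"
        using m_distinct[of x] by (metis distinct_map)
      moreover have "w \<in> set (map Inl points @ map Inr [0..<f])" "w' \<in> set (map Inl points @ map Inr [0..<f])"
        using vw(2,3) by (auto simp: set_points)
      ultimately show ?thesis using eq Inl by (auto dest: inj_onD)
    next
      case (Inr i)
      then have i: "i < f" using vw(1) by auto
      have "inj_on (\<lambda>x. mult_inv U x i) (set points)" "inj_on (\<lambda>j. tab ! i ! j) (set [0..<f])"
        using tab(2,3)[OF i] unfolding distinct_map by blast+
      then show ?thesis
        using eq Inr vw by (cases w; cases w') (auto simp: set_points dest: inj_onD)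
    qed
  qed simp
  have W_closed: "glue U tab (Inr i) (Inr j) \<in> Inr ` {..<f}" if "i \<in> {..<f}" "j \<in> {..<f}" for i j
    using tab_comm that by simp
  have g: "g x y \<in> UNIV \<and> g x y = g y x \<and> g x (g x y) = y" for x y
    by (cases x; cases y) (auto simp: g_def)
  have line_g: "line p (g x y) = line p (g x' y')" if "line p x = line p x'" "line p y = line p y'" for p x x' y y'
  proof -
    have "line p (g x y) = - line p x - line p y" for x y
      by (cases x; cases y; cases p) (auto simp: g_def line_def algebra_simps)
    then show ?thesis using that by simp
  qed
  have block: "glue U tab v w \<in> {x \<in> UNIV. line p x = k} <+> set (0 # U p)"
    if "v \<in> {x \<in> UNIV. line p x = k} <+> set (0 # U p)" "w \<in> {x \<in> UNIV. line p x = k} <+> set (0 # U p)" for p k v w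
  proof (cases v)
    case v: (Inl x)
    show ?thesis
    proof (cases w)
      case (Inl y)
      then have "line p x = k" "line p y = k" using v that by auto
      then show ?thesis using on_line[of p x y] v Inl by (auto split: sum.splits)
    next
      case (Inr j)
      then have "line p x = k" "j \<in> set (0 # U p)" using v that by auto
      then show ?thesis using F(3)[of j p x] v Inr by auto
    qed
  next
    case v: (Inr i)
    then have i: "i \<in> set (0 # U p)" using that by auto
    show ?thesis
    proof (cases w)
      case (Inl y)
      then have "line p y = k" using that by auto
      then show ?thesis using F(3)[OF i, of y] v Inl by auto
    next
      case (Inr j)
      then have "j \<in> set (0 # U p)" using that by auto
      then have "tab ! i ! j \<in> set (0 # U p)" by (rule F(2)[OF i])
      then show ?thesis using v Inr by (simp only: glue.simps InrI)
    qed
  qed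
  have sub: "set (0 # U p) \<subseteq> {..<f}" for p using F(1) by blast
  have cover: "\<exists>p. i \<in> set (0 # U p)" if "i \<in> {..<f}" for i using F_cover that by blast
  have pair: "\<exists>p. line p x = line p y" for x y
  proof -
    obtain a b i a' b' j where xy: "x = (a, b, i)" "y = (a', b', j)" by (metis prod.exhaust)
    show ?thesis
    proof (cases "a = a'")
      case True
      then show ?thesis using xy by (intro exI[of _ None]) (simp add: line_def)
    next
      case False
      \<comment> \<open>A nonzero element is its own inverse, so the slope is a product rather than
        a quotient.\<close>
      then have "(a' - a) * (a' - a) = 1"
        by (cases a; cases a') (simp_all add: z3_diff one_z3_def)
      then have "(b' - b) * (a' - a) * (a' - a) = b' - b" by (simp add: mult.assoc)
      then show ?thesis
        using xy by (intro exI[of _ "Some ((b' - b) * (a' - a))"]) (simp add: line_def algebra_simps)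
    qed
  qed
  have proper: "\<exists>x\<in>UNIV. line p x \<noteq> k" for p k
  proof (cases p)
    case None
    then show ?thesis by (intro bexI[of _ "(k + 1, 0, True)"]) (simp_all add: line_def)
  next
    case (Some s)
    then show ?thesis by (intro bexI[of _ "(0, k + 1, True)"]) (simp_all add: line_def)
  qed
  have "good (3 * card (UNIV :: point set) + card {..<f})"
    by (rule good_three[where \<kappa> = line and F = "\<lambda>p. set (0 # U p)" and g = g,
        OF q W_closed UNIV_not_empty g line_g block sub cover pair proper])
  then show ?thesis by (simp add: card_z3)
qed

text \<open>54 = 3 * 18, and \<open>W\<close> has 1 + 4 + 2 + 2 + 2 = 11 elements. In the table
  every \<open>{0} \<union> U p\<close> is a subquasigroup, of order 5 or 3: the mean modulo 5, or
  three elements of which any two distinct ones give the third.\<close>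

lemma good_65: "good 65"
proof -
  have "glue_ok (\<lambda>p. case p of None \<Rightarrow> [1,2,3,4] | 
      Some s \<Rightarrow> (case s of Z0 \<Rightarrow> [5,6] | Z1 \<Rightarrow> [7,8] | Z2 \<Rightarrow> [9,10]))
    [[0, 3, 1, 4, 2, 6, 5, 8, 7, 10, 9],
     [3, 1, 4, 2, 0, 7, 9, 5, 10, 6, 8],
     [1, 4, 2, 0, 3, 8, 10, 9, 5, 7, 6],
     [4, 2, 0, 3, 1, 10, 7, 6, 9, 8, 5],
     [2, 0, 3, 1, 4, 9, 8, 10, 6, 5, 7],
     [6, 7, 8, 10, 9, 5, 0, 1, 2, 4, 3],
     [5, 9, 10, 7, 8, 0, 6, 3, 4, 1, 2],
     [8, 5, 9, 6, 10, 1, 3, 7, 0, 2, 4],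
     [7, 10, 5, 9, 6, 2, 4, 0, 8, 3, 1],
     [10, 6, 7, 8, 5, 4, 1, 2, 3, 9, 0],
     [9, 8, 6, 5, 7, 3, 2, 4, 1, 0, 10]] 11"
    by code_simp
  from good_glue[OF this] show ?thesis by simp
qed

text \<open>\<open>W\<close> has 1 + 4 + 4 + 4 = 13 elements. The table is itself a filled frame
  with three groups of size 4: addition in the Klein four-group across groups, the mean modulo 5 on
  each group together with 0.\<close>

lemma good_67: "good 67"
proof -
  have "glue_ok (\<lambda>p. case p of None \<Rightarrow> [] |
      Some s \<Rightarrow> (case s of Z0 \<Rightarrow> [1,2,3,4] | Z1 \<Rightarrow> [5,6,7,8] | Z2 \<Rightarrow> [9,10,11,12]))
    [[0, 3, 1, 4, 2, 7, 5, 8, 6, 11, 9, 12, 10],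
     [3, 1, 4, 2, 0, 9, 10, 11, 12, 5, 6, 7, 8],
     [1, 4, 2, 0, 3, 10, 9, 12, 11, 6, 5, 8, 7],
     [4, 2, 0, 3, 1, 11, 12, 9, 10, 7, 8, 5, 6],
     [2, 0, 3, 1, 4, 12, 11, 10, 9, 8, 7, 6, 5],
     [7, 9, 10, 11, 12, 5, 8, 6, 0, 1, 2, 3, 4],
     [5, 10, 9, 12, 11, 8, 6, 0, 7, 2, 1, 4, 3],
     [8, 11, 12, 9, 10, 6, 0, 7, 5, 3, 4, 1, 2],
     [6, 12, 11, 10, 9, 0, 7, 5, 8, 4, 3, 2, 1],
     [11, 5, 6, 7, 8, 1, 2, 3, 4, 9, 12, 10, 0],
     [9, 6, 5, 8, 7, 2, 1, 4, 3, 12, 10, 0, 11],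
     [12, 7, 8, 5, 6, 3, 4, 1, 2, 10, 0, 11, 9],
     [10, 8, 7, 6, 5, 4, 3, 2, 1, 0, 11, 9, 12]] 13"
    by code_simp
  from good_glue[OF this] show ?thesis by simp
qed

text \<open>\<open>W\<close> has 1 + 2 + 4 + 4 + 4 = 15 elements; the table has subquasigroups of
  orders 3, 5, 5, 5 that meet in 0.\<close>

lemma good_69: "good 69"
proof -
  have "glue_ok (\<lambda>p. case p of None \<Rightarrow> [13,14] |
      Some s \<Rightarrow> (case s of Z0 \<Rightarrow> [1,2,3,4] | Z1 \<Rightarrow> [5,6,7,8] | Z2 \<Rightarrow> [9,10,11,12]))
    [[0, 3, 1, 4, 2, 7, 5, 8, 6, 11, 9, 12, 10, 14, 13],
     [3, 1, 4, 2, 0, 9, 10, 11, 13, 5, 6, 7, 14, 8, 12],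
     [1, 4, 2, 0, 3, 14, 11, 9, 12, 7, 13, 6, 8, 10, 5],
     [4, 2, 0, 3, 1, 12, 13, 10, 9, 8, 7, 14, 5, 6, 11],
     [2, 0, 3, 1, 4, 10, 12, 14, 11, 13, 5, 8, 6, 9, 7],
     [7, 9, 14, 12, 10, 5, 8, 6, 0, 1, 4, 13, 3, 11, 2],
     [5, 10, 11, 13, 12, 8, 6, 0, 7, 14, 1, 2, 4, 3, 9],
     [8, 11, 9, 10, 14, 6, 0, 7, 5, 2, 3, 1, 13, 12, 4],
     [6, 13, 12, 9, 11, 0, 7, 5, 8, 3, 14, 4, 2, 1, 10],
     [11, 5, 7, 8, 13, 1, 14, 2, 3, 9, 12, 10, 0, 4, 6],
     [9, 6, 13, 7, 5, 4, 1, 3, 14, 12, 10, 0, 11, 2, 8],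
     [12, 7, 6, 14, 8, 13, 2, 1, 4, 10, 0, 11, 9, 5, 3],
     [10, 14, 8, 5, 6, 3, 4, 13, 2, 0, 11, 9, 12, 7, 1],
     [14, 8, 10, 6, 9, 11, 3, 12, 1, 4, 2, 5, 7, 13, 0],
     [13, 12, 5, 11, 7, 2, 9, 4, 10, 6, 8, 3, 1, 0, 14]] 15"
    by code_simp
  from good_glue[OF this] show ?thesis by simp
qed

section \<open>All orders\<close>

lemma good_15: "good 15"
  using good_weight[OF good_7 _ extends_even[of 1 1]] by simp

lemma good_53: "good 53"
  using good_vectors[of 2 1] extends_even[of 1 2] by simp

lemma good_from_14:
  assumes "odd n" "n mod 14 + 2 * ((n div 14 - 1) div 2) < 2 * (n div 14)"
  shows "good n"
proof -
  have "odd (n mod 14)" using assms(1) by (simp add: dvd_mod_iff)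
  then have "good (7 * (2 * (n div 14)) + n mod 14)"
    using assms(2) by (intro good_weight good_7 extends_even) auto
  moreover have "7 * (2 * (n div 14)) + n mod 14 = n" by presburger
  ultimately show ?thesis by simp
qed

lemma good_odd:
  assumes n: "odd n" "27 \<le> n" "n \<notin> {33, 35, 37, 41, 43, 47, 51}"
  shows "good n"
proof (cases "n mod 14 + 2 * ((n div 14 - 1) div 2) < 2 * (n div 14)")
  case True
  with n(1) show ?thesis by (rule good_from_14)
next
  case False
  define k w where "k = n div 14" and "w = n mod 14"
  have nkw: "n = 14 * k + w" by (simp add: k_def w_def)
  have "odd w" "w < 14" using n(1) by (simp_all add: w_def dvd_mod_iff)
  then have w: "w = 1 \<or> w = 3 \<or> w = 5 \<or> w = 7 \<or> w = 9 \<or> w = 11 \<or> w = 13" by presburger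
  have kw: "\<not> w + 2 * ((k - 1) div 2) < 2 * k" using False by (simp add: k_def w_def)
  \<comment> \<open>The starter allows w < 2 k - 2 ((k - 1) div 2), which is at least k + 1 and so
    enough for k \<ge> 13, as w \<le> 13. For k = 12 rounding helps: the bound is 14.\<close>
  have "k \<noteq> 12" using kw w by auto
  moreover have "k < 13"
  proof -
    define d where "d = (k - 1) div 2"
    have "2 * d \<le> k - 1" by (simp add: d_def)
    then show ?thesis using kw \<open>w < 14\<close> unfolding d_def[symmetric] by linarith
  qed
  moreover have "1 \<le> k" using n(2) by (simp add: k_def)
  ultimately have k: "k = 1 \<or> k = 2 \<or> k = 3 \<or> k = 4 \<or> k = 5 \<or> k = 6 \<or> k = 7 \<or> k = 8 \<or> k = 9 \<or> k = 10 \<or> k = 11"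
    by presburger
  from kw have "n \<in> {27, 39, 49, 53, 55, 63, 65, 67, 69, 77, 79, 81, 83, 93, 95, 97, 107, 109, 111,
      123, 125, 137, 139, 153, 167}"
    using k w n(2,3) unfolding nkw by (elim disjE) simp_all
  moreover have "good 27" "good 49" "good 63" "good 77" "good 81"
    using good_weight[OF good_9 _ extends_0[of 3]] good_weight[OF good_7 _ extends_0[of 7]]
      good_weight[OF good_7 _ extends_0[of 9]] good_weight[OF good_7 _ extends_0[of 11]]
      good_weight[OF good_9 _ extends_0[of 9]] by simp_all
  moreover have "good 39" "good 55" "good 93" "good 95" "good 97" "good 109" "good 111" "good 153" "good 167"
    using good_weight[OF good_9 _ extends_even[of 3 2]] good_weight[OF good_9 _ extends_even[of 1 3]]
      good_weight[OF good_9 _ extends_even[of 3 5]] good_weight[OF good_9 _ extends_even[of 5 5]]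
      good_weight[OF good_9 _ extends_10_7] good_weight[OF good_9 _ extends_even[of 1 6]]
      good_weight[OF good_9 _ extends_even[of 3 6]] good_weight[OF good_9 _ extends_even[of 9 8]]
      good_weight[OF good_9 _ extends_even[of 5 9]] by simp_all
  \<comment> \<open>26 * 3 + 1, 26 * 3 + 5 and 26 * 5 + 7; the last two need the fillings with
    \<open>w\<close> beyond the reach of \<open>extends_even\<close>.\<close>
  moreover have "good 79" "good 83" "good 137"
    using good_vectors[of 3 1] good_vectors[of 3 5] good_vectors[of 5 7]
      extends_even[of 1 3] extends_6_5 extends_10_7 by simp_all
  \<comment> \<open>Orders already obtained are blown up again: 53 * 2 + 1, 15 * 8 + 3, 15 * 8 + 5
    and 69 * 2 + 1.\<close>
  moreover have "good 107" "good 123" "good 125" "good 139"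
    using good_weight[OF good_53 _ extends_even[of 1 1]] good_weight[OF good_15 _ extends_even[of 3 4]]
      good_weight[OF good_15 _ extends_even[of 5 4]] good_weight[OF good_69 _ extends_even[of 1 1]] by simp_all
  ultimately show ?thesis using good_53 good_65 good_67 good_69 by auto
qed

theorem theorem5p5:
  fixes n :: nat
  assumes "odd n" and "n \<ge> 27" and "n \<notin> {33, 35, 37, 41, 43, 47, 51}"
  shows "\<exists>L. latin_square n L \<and> symmetric_ls n L \<and> idempotent_ls n L \<and>
           (\<forall>r\<in>{1..n}. \<forall>c\<in>{1..n}. \<forall>s\<in>{1..n}.
              \<exists>R C S. proper_latin_subsquare n L R C S \<and> r \<in> R \<and> c \<in> C \<and> s \<in> S)"
  using good_imp_latin_square[OF good_odd[OF assms]] .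

end
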